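(* Assume that $T_{\mathbb K}:L^2(\mathbf X,dP)\to L^2(\mathbf X,dP)$ is one-to-one, that $d\rho$ is absolutely continuous with respect to $dP$, and that $\frac{d\rho}{dP}$ is bounded on $\mathbf X$. Let $1\le N\le n$ be integers, let $X_1,\dots,X_n$ be i.i.d. random samples drawn according to $\rho$, let $B_n=\frac1n\big[\mathbb K(X_i,X_j)\big]_{1\le i,j\le n}$ be the Gram matrix and let $$A_N=\frac1n\big[\mathbb K(X_i,X_j)\big]_{1\le i\le n,\,1\le j\le N}$$ be its principal $n\times N$ sub-matrix, with singular values $\mu_1(A_N)\ge\dots\ge\mu_N(A_N)\geq 0$. Let $\kappa_1=\sup_{x\in\mathbf X}\mathbb K(x,x)$. Then for any $1\le m\le N$ (for which the summability condition $$\sum_{i\ge m}\frac{(i-m+1)\,\lambda_i\,\|\varphi_i\|_\rho^2}{\lambda_m\,\|\varphi_m\|_\rho^2}<+\infty$$ holds), we have $$\mathbb E\Big[\sum_{j\ge m}\mu_j(A_N)\Big]\;\lesssim\;\lambda_m\,\|\varphi_m\|_\rho^2 \qquad\text{and}\qquad \mathbb E\Big[\sum_{j\ge m}\mu_j^2(A_N)\Big]\;\lesssim\;\frac{\kappa_1}{m}\,\lambda_m\,\|\varphi_m\|_\rho^2 .$$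
   Context: Let $d\ge 1$ and let $\mathbf X\subset\mathbb R^d$ be compact. Let $\mathbb K:\mathbf X\times\mathbf X\to\mathbb R$ be a Mercer kernel, i.e. continuous, symmetric and positive definite. Let $dP$ be a probability measure with support $\mathbf X$ and $d\rho$ a probability measure supported on $\mathbf X$. Define $T_{\mathbb K}f(x)=\int_{\mathbf X}\mathbb K(x,y)f(y)\,dP(y)$ on $L^2(\mathbf X,dP)$. Let $\lambda_1\ge\lambda_2\ge\cdots\geq 0$ be its eigenvalues (with multiplicity, in decreasing order) and $(\varphi_j)_{j\ge1}$ the corresponding eigenfunctions, orthonormal in $L^2(\mathbf X,dP)$ and continuous on $\mathbf X$. Set $\|\varphi_j\|_\rho^2=\int_{\mathbf X}|\varphi_j(y)|^2\,d\rho(y)$. The expectation is over the sample $X_1,\dots,X_n$, and the sums over $j\ge m$ run over $m\le j\le N$. The notation $a\lesssim b$ means $a\le C\,b$ for some constant $C>0$; the bounds are meant as decay estimates in $m$, with $C$ independent of $m$, $n$ and $N$.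
   Formalization: The constant in ≲ depends on an upper bound S for the summability sum and is uniform over all m whose sum is at most S, and over n, N. With mere finiteness a constant independent of m fails, e.g. λ_i = i^{-4} with the cosine basis on [0,1] and ρ = P. *)

theory Defs
  imports
    "HOL-Analysis.Analysis"
    "HOL-Probability.Probability"
    "Jordan_Normal_Form.Char_Poly"
begin

text \<open>Measures live on the Borel sets of the ambient Euclidean space. A kernel or a function
  on \<open>X\<close> is represented by a total function whose values outside \<open>X\<close> are never used: all
  integrals and all almost-everywhere statements are relativised to \<open>X\<close>.\<close>

definition measure_support :: "'a::topological_space measure \<Rightarrow> 'a set" where
  "measure_support M = {x. \<forall>U. open U \<and> x \<in> U \<longrightarrow> emeasure M U > 0}"

text \<open>As usual for kernels, ``positive definite'' means that all finite Gram matrices are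
  positive semidefinite.\<close>

definition mercer_kernel :: "'a::topological_space set \<Rightarrow> ('a \<Rightarrow> 'a \<Rightarrow> real) \<Rightarrow> bool" where
  "mercer_kernel X K \<longleftrightarrow>
     continuous_on (X \<times> X) (\<lambda>(x, y). K x y) \<and>
     (\<forall>x\<in>X. \<forall>y\<in>X. K x y = K y x) \<and>
     (\<forall>F c. finite F \<and> F \<subseteq> X \<longrightarrow> (\<Sum>x\<in>F. \<Sum>y\<in>F. c x * c y * K x y) \<ge> 0)"

definition square_integrable_on :: "'a measure \<Rightarrow> 'a set \<Rightarrow> ('a \<Rightarrow> real) \<Rightarrow> bool" where
  "square_integrable_on P X f \<longleftrightarrow>
     set_borel_measurable P X f \<and> set_integrable P X (\<lambda>x. (f x)\<^sup>2)"

definition ae_eq_on :: "'a measure \<Rightarrow> 'a set \<Rightarrow> ('a \<Rightarrow> real) \<Rightarrow> ('a \<Rightarrow> real) \<Rightarrow> bool" where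
  "ae_eq_on P X f g \<longleftrightarrow> (AE x in P. x \<in> X \<longrightarrow> f x = g x)"

definition inner_on :: "'a measure \<Rightarrow> 'a set \<Rightarrow> ('a \<Rightarrow> real) \<Rightarrow> ('a \<Rightarrow> real) \<Rightarrow> real" where
  "inner_on P X f g = (LINT x:X|P. f x * g x)"

definition norm_sq_on :: "'a measure \<Rightarrow> 'a set \<Rightarrow> ('a \<Rightarrow> real) \<Rightarrow> real" where
  "norm_sq_on P X f = (LINT x:X|P. \<bar>f x\<bar>\<^sup>2)"

definition integral_op ::
  "'a measure \<Rightarrow> 'a set \<Rightarrow> ('a \<Rightarrow> 'a \<Rightarrow> real) \<Rightarrow> ('a \<Rightarrow> real) \<Rightarrow> 'a \<Rightarrow> real" where
  "integral_op P X K f x = (LINT y:X|P. K x y * f y)"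

definition integral_op_injective ::
  "'a measure \<Rightarrow> 'a set \<Rightarrow> ('a \<Rightarrow> 'a \<Rightarrow> real) \<Rightarrow> bool" where
  "integral_op_injective P X K \<longleftrightarrow>
     (\<forall>f g. square_integrable_on P X f \<and> square_integrable_on P X g \<and>
        ae_eq_on P X (integral_op P X K f) (integral_op P X K g) \<longrightarrow> ae_eq_on P X f g)"

text \<open>The family \<open>(\<lambda>\<^sub>j, \<phi>\<^sub>j)\<close>, \<open>j \<in> J\<close>, lists the eigenvalues in decreasing order and with
  multiplicity. The index set is \<open>{1, 2, \<dots>}\<close>, or \<open>{1, \<dots>, r}\<close> when \<open>L\<^sup>2(X, P)\<close> has finite
  dimension \<open>r\<close> (that is, when \<open>X\<close> is finite). The last clause is what makes the list complete:
  for every real \<open>a\<close>, an \<open>a\<close>-eigenfunction orthogonal to all listed \<open>\<phi>\<^sub>j\<close> with \<open>\<lambda>\<^sub>j = a\<close>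
  vanishes, so those \<open>\<phi>\<^sub>j\<close> form an orthonormal basis of the \<open>a\<close>-eigenspace.\<close>

definition eigen_system ::
  "'a::topological_space measure \<Rightarrow> 'a set \<Rightarrow> ('a \<Rightarrow> 'a \<Rightarrow> real) \<Rightarrow>
   nat set \<Rightarrow> (nat \<Rightarrow> real) \<Rightarrow> (nat \<Rightarrow> 'a \<Rightarrow> real) \<Rightarrow> bool" where
  "eigen_system P X K J lam phi \<longleftrightarrow>
     (J = {1..} \<or> (\<exists>r. J = {1..r})) \<and>
     (\<forall>j\<in>J. 0 \<le> lam j) \<and>
     (\<forall>i\<in>J. \<forall>j\<in>J. i \<le> j \<longrightarrow> lam j \<le> lam i) \<and>
     (\<forall>j\<in>J. continuous_on X (phi j)) \<and>
     (\<forall>i\<in>J. \<forall>j\<in>J. inner_on P X (phi i) (phi j) = (if i = j then 1 else 0)) \<and>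
     (\<forall>j\<in>J. ae_eq_on P X (integral_op P X K (phi j)) (\<lambda>x. lam j * phi j x)) \<and>
     (\<forall>a f. square_integrable_on P X f \<and>
        ae_eq_on P X (integral_op P X K f) (\<lambda>x. a * f x) \<and>
        (\<forall>j\<in>J. lam j = a \<longrightarrow> inner_on P X f (phi j) = 0)
        \<longrightarrow> ae_eq_on P X f (\<lambda>x. 0))"

definition iid_sample ::
  "'w measure \<Rightarrow> 'a::topological_space measure \<Rightarrow> nat \<Rightarrow> (nat \<Rightarrow> 'w \<Rightarrow> 'a) \<Rightarrow> bool" where
  "iid_sample M \<rho> n Z \<longleftrightarrow>
     prob_space M \<and> prob_space.indep_vars M (\<lambda>_. borel) Z {1..n} \<and>
     (\<forall>i\<in>{1..n}. distr M borel (Z i) = \<rho>)"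

text \<open>Matrices are indexed from \<open>0\<close>, samples from \<open>1\<close>.\<close>

definition gram_matrix :: "('a \<Rightarrow> 'a \<Rightarrow> real) \<Rightarrow> nat \<Rightarrow> (nat \<Rightarrow> 'a) \<Rightarrow> real mat" where
  "gram_matrix K n z = mat n n (\<lambda>(i, j). K (z (i + 1)) (z (j + 1)) / real n)"

definition gram_submatrix :: "('a \<Rightarrow> 'a \<Rightarrow> real) \<Rightarrow> nat \<Rightarrow> nat \<Rightarrow> (nat \<Rightarrow> 'a) \<Rightarrow> real mat" where
  "gram_submatrix K n N z = mat n N (\<lambda>(i, j). gram_matrix K n z $$ (i, j))"

text \<open>The singular values of \<open>A\<close> are the square roots of the eigenvalues (with algebraic
  multiplicity) of \<open>A\<^sup>T A\<close>, in decreasing order. A matrix with \<open>N\<close> columns has \<open>N\<close> of them,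
  as the characteristic polynomial of the symmetric matrix \<open>A\<^sup>T A\<close> splits over the reals.\<close>

definition singular_values :: "real mat \<Rightarrow> real list" where
  "singular_values A =
     rev (sorted_list_of_multiset (image_mset sqrt (proots (char_poly (transpose_mat A * A)))))"

definition singular_value :: "nat \<Rightarrow> real mat \<Rightarrow> real" where
  "singular_value j A = singular_values A ! (j - 1)"

text \<open>The sum takes its value in \<open>[0, \<infinity>]\<close>, where \<open>a / 0 = \<infinity>\<close> for \<open>a \<noteq> 0\<close> and \<open>0 / 0 = 0\<close>.
  So if the denominator vanishes, the sum is finite only when all the numerators vanish too.

  Finiteness of this sum for each \<open>m\<close> does not give a bound whose constant is independent
  of \<open>m\<close>: with \<open>\<lambda>\<^sub>i = i powr -4\<close>, uniformly bounded \<open>\<phi>\<^sub>i\<close> and \<open>\<rho> = P\<close>, the expected sums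
  tend to the tails of \<open>\<Sum>\<lambda>\<^sub>i\<close> as \<open>N = n \<rightarrow> \<infinity>\<close>, and these are of order \<open>m * \<lambda>\<^sub>m\<close>.
  The summability condition is therefore used in the form ``at most \<open>S\<close>'', for an arbitrary
  finite \<open>S\<close> fixed before the constant is chosen.\<close>

definition eigen_tail ::
  "'a measure \<Rightarrow> 'a set \<Rightarrow> nat set \<Rightarrow> (nat \<Rightarrow> real) \<Rightarrow> (nat \<Rightarrow> 'a \<Rightarrow> real) \<Rightarrow> nat \<Rightarrow> ennreal" where
  "eigen_tail \<rho> X J lam phi m =
     (\<Sum>\<^sub>\<infinity>i\<in>{i\<in>J. m \<le> i}.
        ennreal (real (i - m + 1) * lam i * norm_sq_on \<rho> X (phi i)) /
        ennreal (lam m * norm_sq_on \<rho> X (phi m)))"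

end

theory Submission
  imports
    Defs
    "Jordan_Normal_Form.Spectral_Radius"
    "Jordan_Normal_Form.Schur_Decomposition"
    "HOL-Combinatorics.List_Permutation"
    "HOL-Complex_Analysis.Great_Picard"
begin

text \<open>By Mercer's theorem the kernel is \<open>\<Sum>\<lambda>\<^sub>i \<phi>\<^sub>i(x) \<phi>\<^sub>i(y)\<close>, so the Gram matrix is a sum of rank one
  matrices, and dropping the first \<open>m - 1\<close> of them leaves a positive semidefinite matrix of trace
  \<open>1/n \<Sum>\<^sub>k \<Sum>\<^bsub>i\<ge>m\<^esub> \<lambda>\<^sub>i \<phi>\<^sub>i(X\<^sub>k)\<^sup>2\<close>. By a Ky Fan argument this trace bounds \<open>\<Sum>\<^bsub>j\<ge>m\<^esub> \<mu>\<^sub>j(A\<^sub>N)\<close>, and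
  its expectation is \<open>\<Sum>\<^bsub>i\<ge>m\<^esub> \<lambda>\<^sub>i \<parallel>\<phi>\<^sub>i\<parallel>\<^sup>2\<close>, which the summability condition bounds by a multiple of
  \<open>\<lambda>\<^sub>m \<parallel>\<phi>\<^sub>m\<parallel>\<^sup>2\<close>. The second estimate follows because \<open>m \<mu>\<^sub>m \<le> \<mu>\<^sub>1 + \<dots> + \<mu>\<^sub>m \<le> \<kappa>\<^sub>1\<close>.\<close>

section \<open>Singular values\<close>

text \<open>Two obstacles shape the argument. A_N is rectangular, so its singular values are not
  eigenvalues of a positive matrix dominated by the Gram matrix. The Ky Fan argument therefore pairs
  left with right singular vectors; the mixed products are split by the arithmetic-geometric mean
  inequality into two sums, each controlled by Bessel's inequality, and \<open>N \<le> n\<close>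
  makes the trace over all \<open>n\<close> points dominate both.

  On the analytic side, \<open>eigen_system\<close> gives completeness only eigenspace by
  eigenspace, and \<open>mercer_kernel\<close> gives positivity only for finite sets of points.
  Mercer's theorem hence needs an eigenfunction in the orthogonal complement of the listed ones
  unless that is zero, and positivity for point masses combined with a density. All of this takes
  place among continuous functions on \<open>X\<close>: \<open>T\<close> preserves continuity, and
  full support of \<open>P\<close> turns almost everywhere equalities into pointwise ones, so the
  expansion holds at every point of \<open>X\<close>.

  The constant depends on \<open>S\<close> alone: as \<open>i - m + 1 \<ge> 1\<close>, the tail of
  the series is at most \<open>S\<close> times its \<open>m\<close>-th term.\<close>

lemma symmetric_mat_real_eigenvector:
  fixes S :: "real mat"
  assumes S: "S \<in> carrier_mat n n" and sym: "transpose_mat S = S" and n: "n > 0"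
  shows "\<exists>v e. v \<in> carrier_vec n \<and> v \<noteq> 0\<^sub>v n \<and> S *\<^sub>v v = e \<cdot>\<^sub>v v"
proof -
  define C where "C = map_mat complex_of_real S"
  have C: "C \<in> carrier_mat n n" using S by (simp add: C_def)
  obtain k where "k \<in> spectrum C" using spectrum_non_empty[OF C n] by auto
  then obtain z where "eigenvector C z k"
    by (auto simp: spectrum_def eigenvalue_def)
  then have z: "z \<in> carrier_vec n" and z0: "z \<noteq> 0\<^sub>v n" and ev: "C *\<^sub>v z = k \<cdot>\<^sub>v z"
    using C by (auto simp: eigenvector_def)
  have Sij: "S $$ (i,j) = S $$ (j,i)" if "i < n" "j < n" for i j
    using arg_cong[OF sym, of "\<lambda>M. M $$ (i,j)"] that S by auto
  have comp: "(\<Sum>j<n. complex_of_real (S $$ (i,j)) * z $ j) = k * z $ i" if "i < n" for i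
  proof -
    have "(C *\<^sub>v z) $ i = k * z $ i" using that z by (simp add: ev)
    moreover have "(C *\<^sub>v z) $ i = (\<Sum>j<n. complex_of_real (S $$ (i,j)) * z $ j)"
      using that z S by (simp add: C_def scalar_prod_def atLeast0LessThan)
    ultimately show ?thesis by simp
  qed
  \<comment> \<open>The Hermitian form of a real symmetric matrix equals its own conjugate; at an
    eigenvector this gives \<open>k = cnj k\<close>.\<close>
  have "k * (\<Sum>i<n. z $ i * cnj (z $ i)) = (\<Sum>i<n. cnj (z $ i) * (k * z $ i))"
    by (simp add: sum_distrib_left mult_ac)
  also have "\<dots> = (\<Sum>i<n. cnj (z $ i) * (\<Sum>j<n. complex_of_real (S $$ (i,j)) * z $ j))"
    by (rule sum.cong) (simp_all add: comp)
  also have "\<dots> = (\<Sum>i<n. \<Sum>j<n. complex_of_real (S $$ (i,j)) * (z $ j * cnj (z $ i)))"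
    by (simp add: sum_distrib_left mult_ac)
  also have "\<dots> = (\<Sum>j<n. \<Sum>i<n. complex_of_real (S $$ (i,j)) * (z $ j * cnj (z $ i)))"
    by (rule sum.swap)
  also have "\<dots> = (\<Sum>j<n. \<Sum>i<n. complex_of_real (S $$ (j,i)) * (z $ j * cnj (z $ i)))"
    by (intro sum.cong) (auto simp: Sij)
  also have "\<dots> = (\<Sum>j<n. z $ j * cnj (\<Sum>i<n. complex_of_real (S $$ (j,i)) * z $ i))"
    by (simp add: sum_distrib_left mult_ac)
  also have "\<dots> = (\<Sum>j<n. z $ j * cnj (k * z $ j))"
    by (rule sum.cong) (simp_all add: comp)
  also have "\<dots> = cnj k * (\<Sum>i<n. z $ i * cnj (z $ i))"
    by (simp add: sum_distrib_left mult_ac)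
  finally have *: "k * (\<Sum>i<n. z $ i * cnj (z $ i)) = cnj k * (\<Sum>i<n. z $ i * cnj (z $ i))" .
  have nn: "(\<Sum>i<n. z $ i * cnj (z $ i)) = of_real (\<Sum>i<n. (cmod (z $ i))\<^sup>2)"
    by (simp add: complex_norm_square[symmetric])
  obtain i0 where i0: "i0 < n" "z $ i0 \<noteq> 0"
    using z z0 by (metis carrier_vecD eq_vecI index_zero_vec(1) index_zero_vec(2))
  have "(\<Sum>i<n. (cmod (z $ i))\<^sup>2) > 0"
    by (rule sum_pos2[of _ i0]) (use i0 in auto)
  then have "(\<Sum>i<n. z $ i * cnj (z $ i)) \<noteq> 0" unfolding nn of_real_eq_0_iff by simp
  with * have "k = cnj k" by simp
  then have kr: "Im k = 0" by (metis Reals_cnj_iff complex_is_Real_iff)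
  have re: "(\<Sum>j<n. S $$ (i,j) * Re (z $ j)) = Re k * Re (z $ i)" if "i < n" for i
    using arg_cong[OF comp[OF that], of Re] by (simp add: kr)
  have im: "(\<Sum>j<n. S $$ (i,j) * Im (z $ j)) = Re k * Im (z $ i)" if "i < n" for i
    using arg_cong[OF comp[OF that], of Im] by (simp add: kr)
  \<comment> \<open>With real \<open>k\<close>, the real and the imaginary part of \<open>z\<close>
    both solve the eigenvalue equation, and at least one of them is nonzero at the coordinate
    \<open>i0\<close>.\<close>
  have key: ?thesis if x: "\<And>i. i < n \<Longrightarrow> (\<Sum>j<n. S $$ (i,j) * x j) = Re k * x i" and "x i0 \<noteq> 0" for x
  proof (intro exI conjI)
    show "vec n x \<in> carrier_vec n" by simp
    show "vec n x \<noteq> 0\<^sub>v n" using that(2) i0 by (metis index_vec index_zero_vec(1))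
    show "S *\<^sub>v vec n x = Re k \<cdot>\<^sub>v vec n x"
      using S by (intro eq_vecI) (auto simp: scalar_prod_def atLeast0LessThan x)
  qed
  show ?thesis
  proof (cases "Re (z $ i0) = 0")
    case False then show ?thesis using key[of "\<lambda>j. Re (z $ j)"] re by blast
  next
    case True
    then have "Im (z $ i0) \<noteq> 0" using i0 complex_eq_iff by auto
    then show ?thesis using key[of "\<lambda>j. Im (z $ j)"] im by blast
  qed
qed

text \<open>The change of basis for the induction that follows: Gram--Schmidt applied to a basis
  starting with \<open>v\<close> keeps \<open>v\<close> as its first vector, and dividing by the
  lengths makes the columns orthonormal.\<close>

lemma orthogonal_mat_with_first_column:
  fixes v :: "real vec"
  assumes v: "v \<in> carrier_vec n" and v0: "v \<noteq> 0\<^sub>v n"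
  shows "\<exists>W c. W \<in> carrier_mat n n \<and> transpose_mat W * W = 1\<^sub>m n \<and> col W 0 = c \<cdot>\<^sub>v v"
proof -
  interpret cof_vec_space n "TYPE(real)" .
  define b where "b = basis_completion v"
  define ws where "ws = gram_schmidt n b"
  from basis_completion[OF v v0, folded b_def]
  have dist_b: "distinct b"
    and indep: "\<not> lin_dep (set b)" and b: "set b \<subseteq> carrier_vec n" and hdb: "hd b = v"
    and len_b: "length b = n" by auto
  from gram_schmidt_result[OF b dist_b indep ws_def]
  have ws: "set ws \<subseteq> carrier_vec n" "corthogonal ws" "length ws = n"
    by (auto simp: len_b)
  have n: "n \<noteq> 0" using v v0 by (metis carrier_vecD eq_vecI index_zero_vec(2) less_nat_zero_code)
  obtain vs where bv: "b = v # vs" using hdb len_b n by (cases b) auto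
  have hdws: "ws ! 0 = v"
    using gram_schmidt_hd[OF v, of vs] ws(3) n unfolding ws_def[unfolded bv, symmetric]
    by (cases ws) auto
  have wsi: "ws ! i \<in> carrier_vec n" if "i < n" for i using ws that by (metis nth_mem subsetD)
  have orth: "(ws ! i \<bullet> ws ! j = 0) = (i \<noteq> j)" if "i < n" "j < n" for i j
    using corthogonalD[OF ws(2), of i j] that ws(3) by simp
  define W where "W = mat n n (\<lambda>(i,j). ws ! j $ i / sqrt (ws ! j \<bullet> ws ! j))"
  have colW: "col W j = (1 / sqrt (ws ! j \<bullet> ws ! j)) \<cdot>\<^sub>v ws ! j" if "j < n" for j
    using that wsi[OF that] by (intro eq_vecI) (auto simp: W_def)
  have W: "W \<in> carrier_mat n n" by (simp add: W_def)
  have "transpose_mat W * W = 1\<^sub>m n"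
  proof (rule eq_matI)
    fix i j assume "i < dim_row (1\<^sub>m n :: real mat)" "j < dim_col (1\<^sub>m n :: real mat)"
    then have ij: "i < n" "j < n" by auto
    have "ws ! j \<bullet> ws ! j \<ge> 0" unfolding scalar_prod_def by (rule sum_nonneg) simp
    then have p: "ws ! j \<bullet> ws ! j > 0" using orth[OF ij(2) ij(2)] by simp
    show "(transpose_mat W * W) $$ (i,j) = 1\<^sub>m n $$ (i,j)"
      using ij W wsi[OF ij(1)] wsi[OF ij(2)] orth[OF ij] p by (cases "i = j") (auto simp: colW)
  qed (use W in auto)
  moreover have "col W 0 = (1 / sqrt (v \<bullet> v)) \<cdot>\<^sub>v v" using colW[of 0] n hdws by simp
  ultimately show ?thesis using W by blast
qed

text \<open>Deflation: in an orthonormal basis starting with an eigenvector, the first column of the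
  matrix vanishes off the diagonal, by symmetry so does the first row, and the remaining block is
  again symmetric.\<close>

lemma symmetric_mat_diagonalizable:
  fixes S :: "real mat"
  assumes "S \<in> carrier_mat n n" and "transpose_mat S = S"
  shows "\<exists>Q. Q \<in> carrier_mat n n \<and> transpose_mat Q * Q = 1\<^sub>m n \<and> diagonal_mat (transpose_mat Q * S * Q)"
  using assms
proof (induction n arbitrary: S)
  case 0
  then show ?case by (intro exI[of _ "1\<^sub>m 0"]) (auto simp: diagonal_mat_def)
next
  case (Suc n S)
  note S = Suc.prems(1) and sym = Suc.prems(2)
  obtain v e where v: "v \<in> carrier_vec (Suc n)" "v \<noteq> 0\<^sub>v (Suc n)" and ev: "S *\<^sub>v v = e \<cdot>\<^sub>v v"
    using symmetric_mat_real_eigenvector[OF S sym] by auto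
  obtain W c where W: "W \<in> carrier_mat (Suc n) (Suc n)" and WW: "transpose_mat W * W = 1\<^sub>m (Suc n)"
    and W0: "col W 0 = c \<cdot>\<^sub>v v"
    using orthogonal_mat_with_first_column[OF v] by blast
  let ?Wt = "transpose_mat W"
  have Wt: "?Wt \<in> carrier_mat (Suc n) (Suc n)" using W by simp
  define A where "A = ?Wt * S * W"
  have A: "A \<in> carrier_mat (Suc n) (Suc n)" using W S by (simp add: A_def)
  have symA: "transpose_mat A = A"
    unfolding A_def using W S Wt sym by (simp add: transpose_mult[of _ "Suc n" "Suc n" _ "Suc n"] assoc_mult_mat[of _ "Suc n" "Suc n" _ "Suc n" _ "Suc n"])
  have Aij: "A $$ (i,j) = A $$ (j,i)" if "i < Suc n" "j < Suc n" for i j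
    using arg_cong[OF symA, of "\<lambda>M. M $$ (i,j)"] that A by auto
  have SW0: "S *\<^sub>v col W 0 = e \<cdot>\<^sub>v col W 0"
    unfolding W0 using S v ev by (simp add: mult_mat_vec smult_smult_assoc mult.commute)
  have A0: "A $$ (i,0) = (if i = 0 then e else 0)" if i: "i < Suc n" for i
  proof -
    have "A = ?Wt * (S * W)"
      unfolding A_def by (rule assoc_mult_mat[OF Wt S W])
    then have "A $$ (i,0) = row ?Wt i \<bullet> col (S * W) 0"
      using i S W Wt by simp
    also have "\<dots> = col W i \<bullet> (S *\<^sub>v col W 0)"
      using i W by (simp add: col_mult2[OF S W])
    also have "\<dots> = e * (transpose_mat W * W) $$ (i,0)"
      unfolding SW0 using W i by simp
    finally show ?thesis using i by (simp add: WW)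
  qed
  define B where "B = mat n n (\<lambda>(i,j). A $$ (Suc i, Suc j))"
  have B: "B \<in> carrier_mat n n" by (simp add: B_def)
  have "transpose_mat B = B" by (intro eq_matI) (auto simp: B_def Aij)
  from Suc.IH[OF B this] obtain P where P: "P \<in> carrier_mat n n" and PP: "transpose_mat P * P = 1\<^sub>m n"
    and D: "diagonal_mat (transpose_mat P * B * P)" by blast
  let ?blk = "\<lambda>a M. four_block_mat (a \<cdot>\<^sub>m 1\<^sub>m 1) (0\<^sub>m 1 n) (0\<^sub>m n 1) (M :: real mat)"
  have Ablk: "A = ?blk e B"
    by (rule eq_matI) (use A A0 Aij in \<open>auto simp: B_def\<close>)
  define Q' where "Q' = ?blk 1 P"
  have Q': "Q' \<in> carrier_mat (Suc n) (Suc n)" using P unfolding Q'_def by auto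
  have tQ': "transpose_mat Q' = ?blk 1 (transpose_mat P)"
    unfolding Q'_def by (subst transpose_four_block_mat) (use P in auto)
  have mulblk: "?blk a M * ?blk b M' = ?blk (a * b) (M * M')"
    if "M \<in> carrier_mat n n" "M' \<in> carrier_mat n n" for a b M M'
    by (subst mult_four_block_mat[of _ 1 1 _ n _ n _ _ 1 _ n]) (use that in auto)
  have Q'Q': "transpose_mat Q' * Q' = 1\<^sub>m (Suc n)"
  proof -
    have "transpose_mat Q' * Q' = ?blk (1 * 1) (transpose_mat P * P)"
      unfolding tQ' unfolding Q'_def by (rule mulblk) (use P in auto)
    also have "\<dots> = 1\<^sub>m (Suc n)" unfolding PP by (rule eq_matI) auto
    finally show ?thesis .
  qed
  have Q'A: "transpose_mat Q' * A * Q' = ?blk e (transpose_mat P * B * P)"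
  proof -
    have "transpose_mat Q' * A = ?blk (1 * e) (transpose_mat P * B)"
      unfolding tQ' Ablk by (rule mulblk) (use P B in auto)
    then have "transpose_mat Q' * A * Q' = ?blk (1 * e) (transpose_mat P * B) * Q'"
      by (rule arg_cong)
    also have "\<dots> = ?blk (1 * e) (transpose_mat P * B) * ?blk 1 P"
      by (simp only: Q'_def)
    also have "\<dots> = ?blk (1 * e * 1) (transpose_mat P * B * P)"
      by (rule mulblk) (use P B in auto)
    finally show ?thesis by (simp only: mult_1_left mult_1_right)
  qed
  define Q where "Q = W * Q'"
  have Q: "Q \<in> carrier_mat (Suc n) (Suc n)" using W Q' by (simp add: Q_def)
  have tQ: "transpose_mat Q = transpose_mat Q' * ?Wt"
    unfolding Q_def using W Q' by (simp add: transpose_mult[of _ "Suc n" "Suc n" _ "Suc n"])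
  have tQ'c: "transpose_mat Q' \<in> carrier_mat (Suc n) (Suc n)" using Q' by simp
  note ass = assoc_mult_mat[of _ "Suc n" "Suc n" _ "Suc n" _ "Suc n"]
  have "transpose_mat Q * Q = transpose_mat Q' * (?Wt * W) * Q'"
    unfolding tQ unfolding Q_def using W Q' tQ'c Wt by (simp add: ass)
  also have "\<dots> = 1\<^sub>m (Suc n)" using WW Q'Q' tQ'c by simp
  finally have 1: "transpose_mat Q * Q = 1\<^sub>m (Suc n)" .
  have "transpose_mat Q * S * Q = transpose_mat Q' * A * Q'"
    unfolding tQ A_def unfolding Q_def using W Q' tQ'c Wt S by (simp add: ass)
  moreover have "diagonal_mat (?blk e (transpose_mat P * B * P))"
    using D P unfolding diagonal_mat_def by auto
  ultimately show ?case using Q 1 Q'A by auto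
qed

lemma proots_prod_list_linear:
  "proots (\<Prod>a\<leftarrow>as. [:- a, 1:]) = mset (as :: 'a :: idom list)"
  by (induction as) (simp_all add: proots_mult prod_list_zero_iff image_iff del: mult_pCons_left)

text \<open>The \<open>v i\<close> are the columns of an orthogonal matrix diagonalising the product
  of the transpose of \<open>A\<close> with \<open>A\<close>, permuted to follow the sorted list.
  The last clause speaks of the images of the \<open>v i\<close> under \<open>A\<close>, since left
  singular vectors would require a division by a singular value that may be
  \<open>0\<close>.\<close>

lemma singular_values_decomposition:
  assumes A: "A \<in> carrier_mat n N"
  obtains v :: "nat \<Rightarrow> nat \<Rightarrow> real" where
    "length (singular_values A) = N"
    "\<And>i j. i \<le> j \<Longrightarrow> j < N \<Longrightarrow> singular_values A ! j \<le> singular_values A ! i"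
    "\<And>j. j < N \<Longrightarrow> singular_values A ! j \<ge> 0"
    "\<And>i j. i < N \<Longrightarrow> j < N \<Longrightarrow> (\<Sum>k<N. v i k * v j k) = of_bool (i = j)"
    "\<And>i j. i < N \<Longrightarrow> j < N \<Longrightarrow>
       (\<Sum>k<n. (\<Sum>l<N. A $$ (k,l) * v i l) * (\<Sum>l<N. A $$ (k,l) * v j l)) =
       (singular_values A ! i)\<^sup>2 * of_bool (i = j)"
proof -
  define S where "S = transpose_mat A * A"
  have At: "transpose_mat A \<in> carrier_mat N n" using A by simp
  have S: "S \<in> carrier_mat N N" using A by (simp add: S_def)
  have "transpose_mat S = S"
    unfolding S_def using transpose_mult[OF At A] by simp
  from symmetric_mat_diagonalizable[OF S this] obtain Q where Q: "Q \<in> carrier_mat N N"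
    and QQ: "transpose_mat Q * Q = 1\<^sub>m N" and D: "diagonal_mat (transpose_mat Q * S * Q)" by blast
  have Qt: "transpose_mat Q \<in> carrier_mat N N" using Q by simp
  define B where "B = A * Q"
  have B: "B \<in> carrier_mat n N" using A Q by (simp add: B_def)
  define E where "E = transpose_mat B * B"
  have E: "E \<in> carrier_mat N N" using B by (simp add: E_def)
  have tB: "transpose_mat B = transpose_mat Q * transpose_mat A"
    unfolding B_def by (rule transpose_mult[OF A Q])
  have "E = transpose_mat Q * transpose_mat A * (A * Q)" by (simp only: E_def tB[symmetric]) (simp only: B_def)
  also have "\<dots> = transpose_mat Q * (transpose_mat A * (A * Q))"
    by (rule assoc_mult_mat[OF Qt At B[unfolded B_def]])
  also have "transpose_mat A * (A * Q) = S * Q"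
    unfolding S_def by (rule assoc_mult_mat[OF At A Q, symmetric])
  finally have "E = transpose_mat Q * (S * Q)" .
  also have "\<dots> = transpose_mat Q * S * Q"
    by (rule assoc_mult_mat[OF Qt S Q, symmetric])
  finally have E2: "E = transpose_mat Q * S * Q" .
  have QQ': "Q * transpose_mat Q = 1\<^sub>m N"
    by (rule mat_mult_left_right_inverse[OF Qt Q QQ])
  have "similar_mat_wit E S (transpose_mat Q) Q"
    by (rule similar_mat_witI[OF QQ QQ' E2 E S Qt Q])
  then have "char_poly S = char_poly E"
    using char_poly_similar by (metis similar_mat_def)
  also have "\<dots> = (\<Prod>a\<leftarrow>diag_mat E. [:- a, 1:])"
    using D E unfolding E2[symmetric] diagonal_mat_def
    by (intro char_poly_upper_triangular[OF E]) (auto intro!: upper_triangularI)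
  finally have "proots (char_poly S) = mset (diag_mat E)"
    by (simp add: proots_prod_list_linear)
  then have sv: "singular_values A = rev (sort (map sqrt (diag_mat E)))"
    unfolding singular_values_def S_def[symmetric]
    by (metis mset_map sorted_list_of_multiset_mset)
  have Eij: "E $$ (i,j) = (\<Sum>k<n. B $$ (k,i) * B $$ (k,j))" if "i < N" "j < N" for i j
    using that B by (simp add: E_def scalar_prod_def atLeast0LessThan)
  have Bkj: "B $$ (k,j) = (\<Sum>l<N. A $$ (k,l) * Q $$ (l,j))" if "k < n" "j < N" for k j
    using that A Q by (simp add: B_def scalar_prod_def atLeast0LessThan)
  have Qij: "(\<Sum>k<N. Q $$ (k,i) * Q $$ (k,j)) = of_bool (i = j)" if "i < N" "j < N" for i j
  proof -
    have "(transpose_mat Q * Q) $$ (i,j) = (\<Sum>k<N. Q $$ (k,i) * Q $$ (k,j))"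
      using that Q by (simp add: scalar_prod_def atLeast0LessThan)
    moreover have "(transpose_mat Q * Q) $$ (i,j) = of_bool (i = j)"
      unfolding QQ using that by simp
    ultimately show ?thesis by simp
  qed
  have len: "length (diag_mat E) = N" using E by (simp add: diag_mat_def)
  have len': "length (singular_values A) = N" unfolding sv by (simp add: len)
  \<comment> \<open>Sorting loses the link between diagonal entries and columns of \<open>Q\<close>;
    the bijection \<open>f\<close> restores it.\<close>
  have "singular_values A <~~> map sqrt (diag_mat E)" unfolding sv by simp
  from permutation_Ex_bij[OF this] obtain f where f: "bij_betw f {..<N} {..<N}"
    and nth: "\<And>i. i < N \<Longrightarrow> singular_values A ! i = map sqrt (diag_mat E) ! f i"
    unfolding len' length_map len by auto
  have fN: "f i < N" if "i < N" for i using f that by (auto simp: bij_betw_def)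
  have finj: "f i = f j \<longleftrightarrow> i = j" if "i < N" "j < N" for i j
    using f that by (auto simp: bij_betw_def inj_on_def)
  have Ediag: "E $$ (i,j) = 0" if "i < N" "j < N" "i \<noteq> j" for i j
    using D E that unfolding E2[symmetric] diagonal_mat_def by auto
  have Enn: "E $$ (i,i) \<ge> 0" if "i < N" for i
    unfolding Eij[OF that that] by (rule sum_nonneg) simp
  have nth': "singular_values A ! i = sqrt (E $$ (f i, f i))" if "i < N" for i
    using nth[OF that] fN[OF that] E len by (simp add: diag_mat_def)
  have sorted: "sorted (rev (singular_values A))" unfolding sv by simp
  show thesis
  proof (rule that[of "\<lambda>i k. Q $$ (k, f i)"])
    show "singular_values A ! j \<le> singular_values A ! i" if "i \<le> j" "j < N" for i j
      using sorted_rev_nth_mono[OF sorted, of i j] that len' by simp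
    show "singular_values A ! j \<ge> 0" if "j < N" for j
      using Enn[OF fN[OF that]] by (simp add: nth'[OF that])
    show "(\<Sum>k<N. Q $$ (k, f i) * Q $$ (k, f j)) = of_bool (i = j)" if "i < N" "j < N" for i j
      using Qij[OF fN fN, OF that] finj[OF that] by simp
    show "(\<Sum>k<n. (\<Sum>l<N. A $$ (k,l) * Q $$ (l, f i)) * (\<Sum>l<N. A $$ (k,l) * Q $$ (l, f j))) =
       (singular_values A ! i)\<^sup>2 * of_bool (i = j)" if "i < N" "j < N" for i j
    proof -
      have "(\<Sum>k<n. (\<Sum>l<N. A $$ (k,l) * Q $$ (l, f i)) * (\<Sum>l<N. A $$ (k,l) * Q $$ (l, f j)))
        = E $$ (f i, f j)"
        unfolding Eij[OF fN fN, OF that] by (rule sum.cong) (auto simp: Bkj fN that)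
      then show ?thesis
        using Ediag[OF fN fN, OF that] finj[OF that] nth'[OF that(1)] Enn[OF fN[OF that(1)]] by auto
    qed
  qed (rule len')
qed

section \<open>A Ky Fan bound for tails of singular values\<close>

text \<open>Padding the \<open>r\<close> equations in \<open>r + 1\<close> unknowns by a zero row
  gives a square matrix with determinant \<open>0\<close>; a vector in its kernel is
  normalised.\<close>

lemma homogeneous_system_nontrivial_solution:
  fixes c :: "nat \<Rightarrow> nat \<Rightarrow> real"
  shows "\<exists>a. (\<Sum>l<Suc r. (a l)\<^sup>2) = 1 \<and> (\<forall>i<r. (\<Sum>l<Suc r. c i l * a l) = 0)"
proof -
  define M where "M = mat (Suc r) (Suc r) (\<lambda>(i,l). if i < r then c i l else 0)"
  have M: "M \<in> carrier_mat (Suc r) (Suc r)" by (simp add: M_def)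
  have "transpose_mat M *\<^sub>v unit_vec (Suc r) r = 0\<^sub>v (Suc r)"
    by (rule eq_vecI) (auto simp: M_def scalar_prod_right_unit)
  then have "det (transpose_mat M) = 0"
    using det_0_iff_vec_prod_zero_field[of "transpose_mat M" "Suc r"] M
    by (metis lessI transpose_carrier_mat unit_vec_carrier unit_vec_nonzero)
  then have "det M = 0" using det_transpose[OF M] by simp
  then obtain x where x: "x \<in> carrier_vec (Suc r)" "x \<noteq> 0\<^sub>v (Suc r)" "M *\<^sub>v x = 0\<^sub>v (Suc r)"
    using det_0_iff_vec_prod_zero_field[OF M] by blast
  have eq: "(\<Sum>l<Suc r. c i l * x $ l) = 0" if "i < r" for i
  proof -
    have "(M *\<^sub>v x) $ i = (\<Sum>l<Suc r. c i l * x $ l)"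
      using that x(1) by (simp add: M_def scalar_prod_def atLeast0LessThan)
    then show ?thesis using that x(3) by simp
  qed
  define s where "s = (\<Sum>l<Suc r. (x $ l)\<^sup>2)"
  obtain l where l: "l < Suc r" "x $ l \<noteq> 0"
    using x by (metis carrier_vecD eq_vecI index_zero_vec(1) index_zero_vec(2))
  have s: "s > 0" unfolding s_def by (rule sum_pos2[of _ l]) (use l in auto)
  have "(\<Sum>l<Suc r. (x $ l / sqrt s)\<^sup>2) = 1"
    using s by (simp add: power_divide s_def[symmetric] sum_divide_distrib[symmetric] del: sum.lessThan_Suc)
  moreover have "(\<Sum>l<Suc r. c i l * (x $ l / sqrt s)) = 0" if "i < r" for i
    using eq[OF that] by (simp add: sum_divide_distrib[symmetric] del: sum.lessThan_Suc)
  ultimately show ?thesis by (intro exI[of _ "\<lambda>l. x $ l / sqrt s"]) simp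
qed

text \<open>Row \<open>j\<close> has \<open>j + 1\<close> free entries and must satisfy only \<open>m + (j - m) = j\<close> linear conditions.\<close>
lemma triangular_orthonormal_system:
  fixes c :: "nat \<Rightarrow> nat \<Rightarrow> real"
  shows "\<exists>a. (\<forall>j l. l > j \<longrightarrow> a j l = 0) \<and>
     (\<forall>j\<in>{m..<r}. \<forall>i<m. (\<Sum>l<r. c i l * a j l) = 0) \<and>
     (\<forall>j\<in>{m..<r}. \<forall>j'\<in>{m..<r}. (\<Sum>l<r. a j l * a j' l) = of_bool (j = j'))"
proof (induction r)
  case 0
  then show ?case by (intro exI[of _ "\<lambda>_ _. 0"]) auto
next
  case (Suc r)
  then obtain a where a: "\<And>j l. l > j \<Longrightarrow> a j l = 0"
    "\<And>j i. j \<in> {m..<r} \<Longrightarrow> i < m \<Longrightarrow> (\<Sum>l<r. c i l * a j l) = 0"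
    "\<And>j j'. j \<in> {m..<r} \<Longrightarrow> j' \<in> {m..<r} \<Longrightarrow> (\<Sum>l<r. a j l * a j' l) = of_bool (j = j')" by blast
  \<comment> \<open>For \<open>i < m\<close> the equations demand orthogonality to
    \<open>c i\<close>, for \<open>m \<le> i < r\<close> to the row \<open>a i\<close> already
    constructed: \<open>r\<close> equations for the \<open>r + 1\<close> entries of row
    \<open>r\<close>.\<close>
  obtain x where x1: "(\<Sum>l<Suc r. (x l)\<^sup>2) = 1"
    and x0: "\<And>i. i < r \<Longrightarrow> (\<Sum>l<Suc r. (if i < m then c i l else a i l) * x l) = 0"
    using homogeneous_system_nontrivial_solution[of r "\<lambda>i l. if i < m then c i l else a i l"] by blast
  define a' where "a' = (\<lambda>j l. if j = r then if l \<le> r then x l else 0 else a j l)"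
  have sm: "(\<Sum>l<Suc r. f l * a j l) = (\<Sum>l<r. f l * a j l)" if "j < r" for f j
    using that a(1) by simp
  have xr: "(\<Sum>l<Suc r. f l * a' r l) = (\<Sum>l<Suc r. f l * x l)" for f
    by (rule sum.cong) (auto simp: a'_def)
  have 1: "a' j l = 0" if "l > j" for j l using that a(1) by (auto simp: a'_def)
  have 2: "(\<Sum>l<Suc r. c i l * a' j l) = 0" if "j \<in> {m..<Suc r}" "i < m" for i j
  proof (cases "j = r")
    case True
    then show ?thesis using x0[of i] that by (simp add: xr del: sum.lessThan_Suc)
  next
    case False
    then have "(\<Sum>l<Suc r. c i l * a' j l) = (\<Sum>l<Suc r. c i l * a j l)" by (simp add: a'_def)
    also have "\<dots> = 0" using False that a(2)[of j i] by (subst sm) auto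
    finally show ?thesis .
  qed
  have 30: "(\<Sum>l<Suc r. a' j l * a' r l) = 0" if "j \<in> {m..<r}" for j
  proof -
    have "(\<Sum>l<Suc r. a' j l * a' r l) = (\<Sum>l<Suc r. a j l * x l)"
      using that by (intro sum.cong) (auto simp: a'_def)
    then show ?thesis using x0[of j] that by (simp del: sum.lessThan_Suc)
  qed
  have 3: "(\<Sum>l<Suc r. a' j l * a' j' l) = of_bool (j = j')"
    if j: "j \<in> {m..<Suc r}" and j': "j' \<in> {m..<Suc r}" for j j'
  proof -
    consider "j = r" "j' = r" | "j = r" "j' \<in> {m..<r}" | "j \<in> {m..<r}" "j' = r" | "j \<in> {m..<r}" "j' \<in> {m..<r}"
      using j j' by force
    then show ?thesis
    proof cases
      case 1
      have "(\<Sum>l<Suc r. a' r l * a' r l) = (\<Sum>l<Suc r. (x l)\<^sup>2)"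
        by (rule sum.cong) (auto simp: a'_def power2_eq_square)
      then show ?thesis using 1 x1 by (simp del: sum.lessThan_Suc)
    next
      case 2
      then show ?thesis using 30[of j'] by (simp add: mult.commute del: sum.lessThan_Suc)
    next
      case 3
      then show ?thesis using 30[of j] by (simp del: sum.lessThan_Suc)
    next
      case 4
      then have "(\<Sum>l<Suc r. a' j l * a' j' l) = (\<Sum>l<Suc r. a j l * a j' l)" by (auto simp: a'_def)
      also have "\<dots> = (\<Sum>l<r. a j l * a j' l)" using 4 by (subst sm) auto
      finally show ?thesis using 4 a(3) by simp
    qed
  qed
  show ?case using 1 2 3 by (intro exI[of _ a']) blast
qed

lemma orthonormal_combination_inner:
  fixes x :: "'i \<Rightarrow> 'k \<Rightarrow> real"
  assumes "finite L" and "\<And>l l'. l \<in> L \<Longrightarrow> l' \<in> L \<Longrightarrow> (\<Sum>k\<in>I. x l k * x l' k) = of_bool (l = l')"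
  shows "(\<Sum>k\<in>I. (\<Sum>l\<in>L. a l * x l k) * (\<Sum>l\<in>L. b l * x l k)) = (\<Sum>l\<in>L. a l * b l)"
proof -
  have "(\<Sum>k\<in>I. (\<Sum>l\<in>L. a l * x l k) * (\<Sum>l\<in>L. b l * x l k)) =
      (\<Sum>k\<in>I. \<Sum>l\<in>L. \<Sum>l'\<in>L. a l * b l' * (x l k * x l' k))"
    by (simp add: sum_product mult_ac)
  also have "\<dots> = (\<Sum>l\<in>L. \<Sum>l'\<in>L. a l * b l' * (\<Sum>k\<in>I. x l k * x l' k))"
    by (subst sum.swap, intro sum.cong refl, subst sum.swap) (simp add: sum_distrib_left)
  also have "\<dots> = (\<Sum>l\<in>L. \<Sum>l'\<in>L. if l = l' then a l * b l' else 0)"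
    by (intro sum.cong refl) (auto simp: assms)
  also have "\<dots> = (\<Sum>l\<in>L. a l * b l)" using assms(1) by (simp add: sum.delta)
  finally show ?thesis .
qed

lemma finite_Bessel_inequality:
  fixes x :: "'i \<Rightarrow> 'k \<Rightarrow> real"
  assumes "finite L" and "\<And>l l'. l \<in> L \<Longrightarrow> l' \<in> L \<Longrightarrow> (\<Sum>k\<in>I. x l k * x l' k) = of_bool (l = l')"
  shows "(\<Sum>l\<in>L. (\<Sum>k\<in>I. b k * x l k)\<^sup>2) \<le> (\<Sum>k\<in>I. (b k)\<^sup>2)"
proof -
  define a where "a l = (\<Sum>k\<in>I. b k * x l k)" for l
  have cross: "(\<Sum>k\<in>I. b k * (\<Sum>l\<in>L. a l * x l k)) = (\<Sum>l\<in>L. (a l)\<^sup>2)"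
    unfolding sum_distrib_left
    by (subst sum.swap) (simp add: a_def power2_eq_square sum_distrib_left mult_ac)
  have "0 \<le> (\<Sum>k\<in>I. (b k - (\<Sum>l\<in>L. a l * x l k))\<^sup>2)" by (simp add: sum_nonneg)
  also have "\<dots> = (\<Sum>k\<in>I. (b k)\<^sup>2) - 2 * (\<Sum>k\<in>I. b k * (\<Sum>l\<in>L. a l * x l k))
      + (\<Sum>k\<in>I. (\<Sum>l\<in>L. a l * x l k) * (\<Sum>l\<in>L. a l * x l k))"
    unfolding power2_eq_square[of "_ - _"] sum_distrib_left[of 2]
    by (simp add: algebra_simps power2_eq_square sum.distrib sum_subtractf)
  also have "\<dots> = (\<Sum>k\<in>I. (b k)\<^sup>2) - (\<Sum>l\<in>L. (a l)\<^sup>2)"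
    using orthonormal_combination_inner[OF assms, of a a] unfolding cross by (simp add: power2_eq_square)
  finally show ?thesis by (simp add: a_def)
qed

text \<open>With \<open>v\<^sub>l\<close>, \<open>u\<^sub>l\<close> the right and left singular vectors, choose orthonormal coefficient vectors
  \<open>a\<^sub>j\<close> (\<open>m \<le> j\<close>) supported on \<open>{0..j}\<close> such that \<open>w\<^sub>j = \<Sum>a\<^sub>j\<^sub>l v\<^sub>l\<close> is orthogonal to \<open>b\<^sub>i\<close> for all \<open>i < m\<close>.
  For \<open>y\<^sub>j = \<Sum>a\<^sub>j\<^sub>l u\<^sub>l\<close> one gets \<open>\<sigma>\<^sub>j \<le> y\<^sub>j \<bullet> A w\<^sub>j = \<Sum>\<^bsub>i\<ge>m\<^esub> (b\<^sub>i \<bullet> y\<^sub>j) (b\<^sub>i \<bullet> w\<^sub>j)\<close>, and Bessel's inequality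
  bounds the sum over \<open>j\<close>. Only the range of the nonzero singular values (\<open>j < r\<close>) matters, since
  \<open>u\<^sub>j\<close> is undefined beyond it.\<close>
lemma singular_value_tail_bound:
  fixes b :: "nat \<Rightarrow> nat \<Rightarrow> real"
  assumes A: "A \<in> carrier_mat n N" and "N \<le> n"
    and b: "\<And>k p. k < n \<Longrightarrow> p < N \<Longrightarrow> (\<lambda>i. b i k * b i p) sums (A $$ (k,p))"
    and T: "(\<lambda>i. \<Sum>k<n. (b (i + m) k)\<^sup>2) sums T"
  shows "(\<Sum>j\<in>{m..<N}. singular_values A ! j) \<le> T"
proof -
  obtain v :: "nat \<Rightarrow> nat \<Rightarrow> real" where
    "length (singular_values A) = N" and
    dec: "\<And>i j. i \<le> j \<Longrightarrow> j < N \<Longrightarrow> singular_values A ! j \<le> singular_values A ! i" and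
    nonneg: "\<And>j. j < N \<Longrightarrow> singular_values A ! j \<ge> 0" and
    v: "\<And>i j. i < N \<Longrightarrow> j < N \<Longrightarrow> (\<Sum>k<N. v i k * v j k) = of_bool (i = j)" and
    Av: "\<And>i j. i < N \<Longrightarrow> j < N \<Longrightarrow>
       (\<Sum>k<n. (\<Sum>l<N. A $$ (k,l) * v i l) * (\<Sum>l<N. A $$ (k,l) * v j l)) =
       (singular_values A ! i)\<^sup>2 * of_bool (i = j)"
    by (rule singular_values_decomposition[OF A]) (rule that)
  define \<sigma> where "\<sigma> j = singular_values A ! j" for j
  define r where "r = (LEAST r. r = N \<or> (r < N \<and> \<sigma> r = 0))"
  have r: "r = N \<or> (r < N \<and> \<sigma> r = 0)" unfolding r_def by (rule LeastI[of _ N]) simp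
  then have rN: "r \<le> N" by auto
  have pos: "\<sigma> j > 0" if "j < r" for j
  proof -
    have "\<not> (j = N \<or> (j < N \<and> \<sigma> j = 0))" using that unfolding r_def by (rule not_less_Least)
    then show ?thesis using nonneg[of j] that rN by (auto simp: \<sigma>_def)
  qed
  have zero: "\<sigma> j = 0" if "r \<le> j" "j < N" for j
    using dec[OF that] nonneg[OF that(2)] r that by (auto simp: \<sigma>_def)
  define u where "u l k = (\<Sum>p<N. A $$ (k,p) * v l p) / \<sigma> l" for l k
  have u: "(\<Sum>k<n. u l k * u l' k) = of_bool (l = l')" if "l < r" "l' < r" for l l'
  proof -
    have "(\<Sum>k<n. u l k * u l' k) = (\<sigma> l)\<^sup>2 * of_bool (l = l') / (\<sigma> l * \<sigma> l')"
      using Av[of l l'] that rN by (simp add: u_def \<sigma>_def[symmetric] sum_divide_distrib[symmetric])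
    then show ?thesis using pos[OF that(1)] by (auto simp: power2_eq_square)
  qed
  have Avu: "(\<Sum>p<N. A $$ (k,p) * v l p) = \<sigma> l * u l k" if "l < r" for l k
    using pos[OF that] by (simp add: u_def)
  obtain a where
    a0: "\<And>j l. l > j \<Longrightarrow> a j l = 0" and
    ac: "\<And>j i. j \<in> {m..<r} \<Longrightarrow> i < m \<Longrightarrow> (\<Sum>l<r. (\<Sum>p<N. b i p * v l p) * a j l) = 0" and
    a1: "\<And>j j'. j \<in> {m..<r} \<Longrightarrow> j' \<in> {m..<r} \<Longrightarrow> (\<Sum>l<r. a j l * a j' l) = of_bool (j = j')"
    using triangular_orthonormal_system[of m r "\<lambda>i l. \<Sum>p<N. b i p * v l p"] by blast
  define w where "w j p = (\<Sum>l<r. a j l * v l p)" for j p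
  define y where "y j k = (\<Sum>l<r. a j l * u l k)" for j k
  \<comment> \<open>Coordinates of \<open>w j\<close> and \<open>y j\<close> along
    \<open>b i\<close>. By the expansion of \<open>A\<close>, the bilinear form of \<open>A\<close>
    at \<open>y j\<close> and \<open>w j\<close> is the series of the products
    \<open>cy i j * cw i j\<close>.\<close>
  define cw where "cw i j = (\<Sum>p<N. b i p * w j p)" for i j
  define cy where "cy i j = (\<Sum>k<n. b i k * y j k)" for i j
  have w1: "(\<Sum>p<N. w j p * w j' p) = of_bool (j = j')" if "j \<in> {m..<r}" "j' \<in> {m..<r}" for j j'
    unfolding w_def using rN a1[OF that]
    by (subst orthonormal_combination_inner) (auto simp: v)
  have y1: "(\<Sum>p<n. y j p * y j' p) = of_bool (j = j')" if "j \<in> {m..<r}" "j' \<in> {m..<r}" for j j'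
    unfolding y_def using a1[OF that]
    by (subst orthonormal_combination_inner) (auto simp: u)
  have cw0: "cw i j = 0" if "i < m" "j \<in> {m..<r}" for i j
  proof -
    have "cw i j = (\<Sum>l<r. (\<Sum>p<N. b i p * v l p) * a j l)"
      unfolding cw_def w_def by (simp add: sum_distrib_left sum_distrib_right mult_ac) (rule sum.swap)
    then show ?thesis using ac[OF that(2,1)] by simp
  qed
  have form: "(\<Sum>k<n. \<Sum>p<N. y j k * (A $$ (k,p) * w j p)) \<ge> \<sigma> j" if j: "j \<in> {m..<r}" for j
  proof -
    have Aw: "(\<Sum>p<N. A $$ (k,p) * w j p) = (\<Sum>l<r. (a j l * \<sigma> l) * u l k)" for k
    proof -
      have "(\<Sum>p<N. A $$ (k,p) * w j p) = (\<Sum>l<r. a j l * (\<Sum>p<N. A $$ (k,p) * v l p))"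
        unfolding w_def by (simp add: sum_distrib_left mult_ac) (rule sum.swap)
      also have "\<dots> = (\<Sum>l<r. (a j l * \<sigma> l) * u l k)" by (rule sum.cong) (simp_all add: Avu)
      finally show ?thesis .
    qed
    have "(\<Sum>k<n. \<Sum>p<N. y j k * (A $$ (k,p) * w j p)) = (\<Sum>k<n. y j k * (\<Sum>p<N. A $$ (k,p) * w j p))"
      by (simp add: sum_distrib_left)
    also have "\<dots> = (\<Sum>l<r. a j l * (a j l * \<sigma> l))"
      unfolding Aw unfolding y_def
      by (subst orthonormal_combination_inner) (auto simp: u)
    also have "\<dots> \<ge> (\<Sum>l<r. a j l * a j l * \<sigma> j)"
    proof (rule sum_mono)
      fix l assume "l \<in> {..<r}"
      show "a j l * a j l * \<sigma> j \<le> a j l * (a j l * \<sigma> l)"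
      \<comment> \<open>The triangular shape enters here: entries of \<open>a j\<close> beyond
        \<open>j\<close> vanish, and up to \<open>j\<close> the decreasing order gives
        \<open>\<sigma> j \<le> \<sigma> l\<close>.\<close>
      proof (cases "l \<le> j")
        case True
        then have "\<sigma> j \<le> \<sigma> l" using dec[of l j] j rN by (auto simp: \<sigma>_def)
        then have "(a j l * a j l) * \<sigma> j \<le> (a j l * a j l) * \<sigma> l" by (rule mult_left_mono) simp
        then show ?thesis by (simp add: mult.assoc)
      qed (use a0 in auto)
    qed
    moreover have "(\<Sum>l<r. a j l * a j l * \<sigma> j) = \<sigma> j"
      using a1[OF j j] by (simp add: sum_distrib_right[symmetric])
    ultimately show ?thesis by linarith
  qed
  have S: "(\<lambda>i. cy i j * cw i j) sums (\<Sum>k<n. \<Sum>p<N. y j k * (A $$ (k,p) * w j p))" for j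
  proof -
    have "(\<lambda>i. \<Sum>k<n. \<Sum>p<N. y j k * (b i k * b i p * w j p)) sums
        (\<Sum>k<n. \<Sum>p<N. y j k * (A $$ (k,p) * w j p))"
      using b by (intro sums_sum sums_mult sums_mult2) auto
    moreover have "(\<Sum>k<n. \<Sum>p<N. y j k * (b i k * b i p * w j p)) = cy i j * cw i j" for i
      unfolding cy_def cw_def sum_product by (simp add: mult_ac)
    ultimately show ?thesis by simp
  qed
  define V where "V = (\<Sum>j\<in>{m..<r}. \<Sum>k<n. \<Sum>p<N. y j k * (A $$ (k,p) * w j p))"
  have "(\<lambda>i. \<Sum>j\<in>{m..<r}. cy i j * cw i j) sums V"
    unfolding V_def by (intro sums_sum S)
  moreover have "(\<Sum>j\<in>{m..<r}. cy i j * cw i j) = 0" if "i < m" for i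
    using cw0[OF that] by (simp add: sum.neutral)
  \<comment> \<open>The terms \<open>i < m\<close> vanish by the choice of \<open>a\<close>, so the
    series may start at \<open>m\<close>, just as the one for \<open>T\<close> does.\<close>
  ultimately have SV: "(\<lambda>i. \<Sum>j\<in>{m..<r}. cy (i + m) j * cw (i + m) j) sums V"
    by (subst sums_zero_iff_shift) auto
  have "(\<Sum>j\<in>{m..<r}. cy i j * cw i j) \<le> (\<Sum>k<n. (b i k)\<^sup>2)" for i
  proof -
    have 1: "(\<Sum>j\<in>{m..<r}. (cy i j)\<^sup>2) \<le> (\<Sum>k<n. (b i k)\<^sup>2)"
      unfolding cy_def by (rule finite_Bessel_inequality) (auto simp: y1)
    have "(\<Sum>j\<in>{m..<r}. (cw i j)\<^sup>2) \<le> (\<Sum>k<N. (b i k)\<^sup>2)"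
      unfolding cw_def by (rule finite_Bessel_inequality) (auto simp: w1)
    \<comment> \<open>The vectors \<open>w j\<close> have \<open>N\<close> coordinates and the
      \<open>y j\<close> have \<open>n\<close>; \<open>N \<le> n\<close> brings both to the same
      bound.\<close>
    also have "\<dots> \<le> (\<Sum>k<n. (b i k)\<^sup>2)" by (rule sum_mono2) (use \<open>N \<le> n\<close> in auto)
    finally have 2: "(\<Sum>j\<in>{m..<r}. (cw i j)\<^sup>2) \<le> (\<Sum>k<n. (b i k)\<^sup>2)" .
    have "cy i j * cw i j \<le> ((cy i j)\<^sup>2 + (cw i j)\<^sup>2) / 2" for j
      using sum_squares_bound[of "cy i j" "cw i j"] by simp
    then have "(\<Sum>j\<in>{m..<r}. cy i j * cw i j) \<le> (\<Sum>j\<in>{m..<r}. ((cy i j)\<^sup>2 + (cw i j)\<^sup>2) / 2)"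
      by (intro sum_mono)
    also have "\<dots> = ((\<Sum>j\<in>{m..<r}. (cy i j)\<^sup>2) + (\<Sum>j\<in>{m..<r}. (cw i j)\<^sup>2)) / 2"
      by (simp add: sum_divide_distrib[symmetric] sum.distrib)
    finally show ?thesis using 1 2 by simp
  qed
  then have "V \<le> T" by (intro sums_le[OF _ SV T]) simp
  moreover have "(\<Sum>j\<in>{m..<N}. \<sigma> j) = (\<Sum>j\<in>{m..<r}. \<sigma> j)"
    using rN zero by (intro sum.mono_neutral_right) auto
  moreover have "(\<Sum>j\<in>{m..<r}. \<sigma> j) \<le> V"
    unfolding V_def by (intro sum_mono form)
  ultimately show ?thesis by (simp add: \<sigma>_def)
qed

section \<open>Mercer's theorem\<close>

text \<open>\<open>Q\<close> stands for \<open>P\<close> restricted to \<open>X\<close>. Full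
  support enters through its consequence for continuous functions, which lets everything below be
  pointwise on \<open>X\<close> instead of dealing with L^2 classes.\<close>

locale compact_kernel = prob_space Q
  for Q :: "'a::euclidean_space measure" +
  fixes X :: "'a set" and K :: "'a \<Rightarrow> 'a \<Rightarrow> real"
  assumes compact_X: "compact X"
    and sets_Q: "sets Q = sets (restrict_space borel X)"
    and full_support: "\<And>f x. continuous_on X f \<Longrightarrow> (AE x in Q. f x = (0::real)) \<Longrightarrow> x \<in> X \<Longrightarrow> f x = 0"
    and K_cont: "continuous_on (X \<times> X) (\<lambda>(x, y). K x y)"
    and K_sym: "\<And>x y. x \<in> X \<Longrightarrow> y \<in> X \<Longrightarrow> K x y = K y x"
begin

definition T :: "('a \<Rightarrow> real) \<Rightarrow> 'a \<Rightarrow> real" where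
  "T f x = (\<integral>y. K x y * f y \<partial>Q)"

definition ip :: "('a \<Rightarrow> real) \<Rightarrow> ('a \<Rightarrow> real) \<Rightarrow> real" where
  "ip f g = (\<integral>x. f x * g x \<partial>Q)"

lemma space_Q: "space Q = X"
  using sets_eq_imp_space_eq[OF sets_Q] by (simp add: space_restrict_space)

lemma measurable_continuous: "continuous_on X f \<Longrightarrow> f \<in> borel_measurable Q"
  for f :: "'a \<Rightarrow> real"
  using borel_measurable_continuous_on_restrict measurable_cong_sets[OF sets_Q refl] by blast

lemma continuous_bounded:
  fixes f :: "'a \<Rightarrow> real"
  assumes "continuous_on X f" obtains B where "B > 0" "\<And>x. x \<in> X \<Longrightarrow> \<bar>f x\<bar> \<le> B"
  using compact_imp_bounded[OF compact_continuous_image[OF assms compact_X]]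
  by (metis bounded_pos imageI real_norm_def)

lemma integrable_continuous:
  fixes f :: "'a \<Rightarrow> real"
  assumes "continuous_on X f" shows "integrable Q f"
proof -
  obtain B where "\<And>x. x \<in> X \<Longrightarrow> \<bar>f x\<bar> \<le> B" using continuous_bounded[OF assms] by metis
  then show ?thesis
    by (intro integrable_const_bound[of _ B] measurable_continuous[OF assms] AE_I2) (auto simp: space_Q)
qed

lemma K_cont1: "x \<in> X \<Longrightarrow> continuous_on X (K x)"
  using continuous_on_compose2[OF K_cont, of X "\<lambda>y. (x, y)"]
  by (simp add: continuous_on_Pair image_subset_iff)

lemma K_cont_diag: "continuous_on X (\<lambda>x. K x x)"
  using continuous_on_compose2[OF K_cont, of X "\<lambda>y. (y, y)"]
  by (simp add: continuous_on_Pair image_subset_iff)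

lemma K_bounded: obtains \<kappa> where "\<kappa> > 0" "\<And>x y. x \<in> X \<Longrightarrow> y \<in> X \<Longrightarrow> \<bar>K x y\<bar> \<le> \<kappa>"
proof -
  have "bounded ((\<lambda>(x, y). K x y) ` (X \<times> X))"
    by (intro compact_imp_bounded compact_continuous_image K_cont compact_Times compact_X)
  then obtain B where "B > 0" "\<forall>x\<in>X. \<forall>y\<in>X. \<bar>K x y\<bar> \<le> B"
    by (auto simp: bounded_pos)
  then show thesis using that by blast
qed

lemma K_equicontinuous:
  assumes "e > 0"
  obtains d where "d > 0"
    "\<And>x x' y. x \<in> X \<Longrightarrow> x' \<in> X \<Longrightarrow> y \<in> X \<Longrightarrow> dist x x' < d \<Longrightarrow> \<bar>K x y - K x' y\<bar> \<le> e"
proof -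
  have "uniformly_continuous_on (X \<times> X) (\<lambda>(x, y). K x y)"
    by (intro compact_uniformly_continuous K_cont compact_Times compact_X)
  then obtain d where d: "d > 0"
    "\<And>p p'. p \<in> X \<times> X \<Longrightarrow> p' \<in> X \<times> X \<Longrightarrow> dist p' p < d \<Longrightarrow>
      dist ((\<lambda>(x, y). K x y) p') ((\<lambda>(x, y). K x y) p) < e"
    using assms unfolding uniformly_continuous_on_def by metis
  show thesis
  proof (rule that[OF d(1)])
    fix x x' y assume "x \<in> X" "x' \<in> X" "y \<in> X" "dist x x' < d"
    then show "\<bar>K x y - K x' y\<bar> \<le> e"
      using d(2)[of "(x', y)" "(x, y)"] by (simp add: dist_Pair_Pair dist_real_def)
  qed
qed

lemma integrable_mult: "continuous_on X f \<Longrightarrow> continuous_on X g \<Longrightarrow> integrable Q (\<lambda>x. f x * g x)"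
  for f g :: "'a \<Rightarrow> real"
  by (intro integrable_continuous continuous_intros)

lemma T_eq_ip: "T f x = ip f (K x)"
  by (simp add: T_def ip_def mult.commute)

lemma ip_commute: "ip f g = ip g f"
  by (simp add: ip_def mult.commute)

lemma ip_cong: "(\<And>x. x \<in> X \<Longrightarrow> f x = f' x) \<Longrightarrow> (\<And>x. x \<in> X \<Longrightarrow> g x = g' x) \<Longrightarrow> ip f g = ip f' g'"
  unfolding ip_def by (rule Bochner_Integration.integral_cong) (auto simp: space_Q)

lemma ip_add_left:
  assumes "continuous_on X f" "continuous_on X g" "continuous_on X h"
  shows "ip (\<lambda>x. f x + c * g x) h = ip f h + c * ip g h"
proof -
  have "ip (\<lambda>x. f x + c * g x) h = (\<integral>x. f x * h x + c * (g x * h x) \<partial>Q)"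
    by (simp add: ip_def algebra_simps)
  also have "\<dots> = ip f h + c * ip g h"
    unfolding ip_def
    by (simp add: Bochner_Integration.integral_add integrable_mult assms)
  finally show ?thesis .
qed

lemma ip_add_right:
  assumes "continuous_on X f" "continuous_on X g" "continuous_on X h"
  shows "ip h (\<lambda>x. f x + c * g x) = ip h f + c * ip h g"
  using ip_add_left[OF assms] by (simp add: ip_commute)

lemma ip_scale: "ip (\<lambda>x. c * f x) g = c * ip f g"
  by (simp add: ip_def mult.assoc)

lemma T_scale: "T (\<lambda>x. c * f x) x = c * T f x"
  unfolding T_eq_ip by (rule ip_scale)

lemma T_add:
  assumes "continuous_on X f" "continuous_on X g" "x \<in> X"
  shows "T (\<lambda>x. f x + c * g x) x = T f x + c * T g x"
  unfolding T_eq_ip using assms K_cont1 by (intro ip_add_left) auto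

lemma ip_sum_left:
  assumes "\<And>i. i \<in> I \<Longrightarrow> continuous_on X (f i)" "continuous_on X h"
  shows "ip (\<lambda>x. \<Sum>i\<in>I. c i * f i x) h = (\<Sum>i\<in>I. c i * ip (f i) h)"
proof -
  have "ip (\<lambda>x. \<Sum>i\<in>I. c i * f i x) h = (\<integral>x. (\<Sum>i\<in>I. c i * (f i x * h x)) \<partial>Q)"
    by (simp add: ip_def sum_distrib_right mult.assoc)
  also have "\<dots> = (\<Sum>i\<in>I. c i * ip (f i) h)"
    unfolding ip_def by (subst Bochner_Integration.integral_sum) (auto intro!: integrable_mult assms integrable_mult_right)
  finally show ?thesis .
qed

lemma ip_nonneg: "ip f f \<ge> 0"
  unfolding ip_def by (rule integral_nonneg_AE) simp

lemma ip_self_eq_0: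
  assumes "continuous_on X f" "ip f f = 0" "x \<in> X"
  shows "f x = 0"
proof -
  have "AE x in Q. 0 \<le> f x * f x" by simp
  from iffD1[OF integral_nonneg_eq_0_iff_AE[OF integrable_mult[OF assms(1,1)] this] assms(2)[unfolded ip_def]]
  have "AE x in Q. f x = 0" by eventually_elim simp
  then show ?thesis by (rule full_support[OF assms(1) _ assms(3)])
qed

text \<open>The variance of \<open>\<bar>f\<bar>\<close> is nonnegative, as \<open>Q\<close> has
  mass \<open>1\<close>.\<close>

lemma integral_abs_le:
  assumes "continuous_on X f" shows "(\<integral>x. \<bar>f x\<bar> \<partial>Q) \<le> sqrt (ip f f)"
proof -
  define c where "c = (\<integral>x. \<bar>f x\<bar> \<partial>Q)"
  have i1: "integrable Q (\<lambda>x. \<bar>f x\<bar>)" using integrable_continuous[OF assms] by simp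
  have i2: "integrable Q (\<lambda>x. f x * f x)" by (rule integrable_mult[OF assms assms])
  have "0 \<le> (\<integral>x. (\<bar>f x\<bar> - c)\<^sup>2 \<partial>Q)" by (rule integral_nonneg_AE) simp
  also have "\<dots> = (\<integral>x. f x * f x - 2 * c * \<bar>f x\<bar> + c\<^sup>2 \<partial>Q)"
    by (rule Bochner_Integration.integral_cong) (simp_all add: power2_diff, simp add: power2_eq_square)
  also have "\<dots> = ip f f - 2 * c * c + c\<^sup>2"
    unfolding ip_def c_def using i1 i2 by (simp add: prob_space)
  finally have "c\<^sup>2 \<le> ip f f" by (simp add: power2_eq_square)
  then show ?thesis unfolding c_def[symmetric] by (rule real_le_rsqrt)
qed

text \<open>An L^2 bound for \<open>f\<close> against a sup bound for \<open>h\<close>: the form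
  needed when \<open>h\<close> is a section of the kernel, a difference of two sections or the error
  of a uniform limit.\<close>

lemma ip_bound:
  assumes "continuous_on X f" "continuous_on X h" "\<And>x. x \<in> X \<Longrightarrow> \<bar>h x\<bar> \<le> B"
  shows "\<bar>ip f h\<bar> \<le> B * sqrt (ip f f)"
proof -
  have B: "B \<ge> 0" using assms(3) not_empty space_Q by fastforce
  have "\<bar>ip f h\<bar> \<le> (\<integral>x. \<bar>f x * h x\<bar> \<partial>Q)"
    unfolding ip_def by (rule integral_abs_bound)
  also have "\<dots> \<le> (\<integral>x. B * \<bar>f x\<bar> \<partial>Q)"
  proof (rule integral_mono)
    show "integrable Q (\<lambda>x. \<bar>f x * h x\<bar>)" using integrable_mult[OF assms(1,2)] by simp
    show "integrable Q (\<lambda>x. B * \<bar>f x\<bar>)" using integrable_continuous[OF assms(1)] by simp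
    show "\<bar>f x * h x\<bar> \<le> B * \<bar>f x\<bar>" if "x \<in> space Q" for x
      using mult_right_mono[OF assms(3)[of x], of "\<bar>f x\<bar>"] that by (simp add: abs_mult space_Q mult.commute)
  qed
  also have "\<dots> \<le> B * sqrt (ip f f)"
    using integral_abs_le[OF assms(1)] B by (simp add: mult_left_mono)
  finally show ?thesis .
qed

text \<open>The bound \<open>e\<close> comes from the kernel alone, so \<open>T\<close> sends
  families bounded in L^2 to equicontinuous ones, as Arzela--Ascoli demands.\<close>

lemma T_diff_bound:
  assumes "continuous_on X f" "x \<in> X" "x' \<in> X" "\<And>y. y \<in> X \<Longrightarrow> \<bar>K x y - K x' y\<bar> \<le> e"
  shows "\<bar>T f x - T f x'\<bar> \<le> e * sqrt (ip f f)"
proof -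
  have "T f x - T f x' = ip f (\<lambda>y. K x y - K x' y)"
    using ip_add_right[of "K x" "K x'" f "-1"] assms K_cont1 by (simp add: T_eq_ip)
  also have "\<bar>\<dots>\<bar> \<le> e * sqrt (ip f f)"
    using assms K_cont1 by (intro ip_bound continuous_intros) auto
  finally show ?thesis .
qed

lemma T_continuous:
  assumes "continuous_on X f" shows "continuous_on X (T f)"
  unfolding continuous_on_iff
proof (intro ballI allI impI)
  fix x e :: real and x0 assume "x0 \<in> X" "e > 0"
  define s where "s = sqrt (ip f f) + 1"
  have s: "s > 0" using ip_nonneg[of f] by (simp add: s_def add_nonneg_pos)
  obtain d where d: "d > 0"
    "\<And>x x' y. x \<in> X \<Longrightarrow> x' \<in> X \<Longrightarrow> y \<in> X \<Longrightarrow> dist x x' < d \<Longrightarrow> \<bar>K x y - K x' y\<bar> \<le> e / (2 * s)"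
    using K_equicontinuous[of "e / (2 * s)"] \<open>e > 0\<close> s by auto
  show "\<exists>d>0. \<forall>x'\<in>X. dist x' x0 < d \<longrightarrow> dist (T f x') (T f x0) < e"
  proof (intro exI conjI ballI impI)
    fix x' assume "x' \<in> X" "dist x' x0 < d"
    then have "\<bar>T f x' - T f x0\<bar> \<le> e / (2 * s) * sqrt (ip f f)"
      using d(2) \<open>x0 \<in> X\<close> by (intro T_diff_bound assms) auto
    also have "\<dots> \<le> e / (2 * s) * s"
      using \<open>e > 0\<close> s by (intro mult_left_mono) (auto simp: s_def)
    also have "\<dots> < e" using s \<open>e > 0\<close> by (simp add: field_simps)
    finally show "dist (T f x') (T f x0) < e" by (simp add: dist_real_def)
  qed (rule d(1))
qed

text \<open>Fubini asks for measurability in the product \<sigma>-algebra. On Euclidean spaces the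
  product of the Borel \<sigma>-algebras is the Borel \<sigma>-algebra of the product, where
  continuity on a compact square suffices.\<close>

lemma K_measurable: "(\<lambda>(x, y). K x y) \<in> borel_measurable (Q \<Otimes>\<^sub>M Q)"
proof -
  have id: "(\<lambda>x. x) \<in> Q \<rightarrow>\<^sub>M borel"
    using measurable_restrict_space1[of "\<lambda>x. x" borel borel X] measurable_cong_sets[OF sets_Q refl] by auto
  have "(\<lambda>p. (fst p, snd p)) \<in> Q \<Otimes>\<^sub>M Q \<rightarrow>\<^sub>M borel \<Otimes>\<^sub>M borel"
    by (intro measurable_Pair measurable_compose[OF measurable_fst id] measurable_compose[OF measurable_snd id])
  then have pair: "(\<lambda>p. p) \<in> Q \<Otimes>\<^sub>M Q \<rightarrow>\<^sub>M (borel :: ('a \<times> 'a) measure)" by (simp add: borel_prod)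
  have "(\<lambda>p. indicator (X \<times> X) p *\<^sub>R (\<lambda>(x, y). K x y) p) \<in> borel_measurable borel"
    by (intro borel_measurable_continuous_on_indicator K_cont borel_compact compact_Times compact_X)
  from measurable_compose[OF pair this] show ?thesis
    by (subst measurable_cong[where g = "\<lambda>p. indicator (X \<times> X) p *\<^sub>R (\<lambda>(x, y). K x y) p"])
       (auto simp: space_pair_measure space_Q)
qed

lemma T_symmetric:
  assumes f: "continuous_on X f" and g: "continuous_on X g"
  shows "ip (T f) g = ip f (T g)"
proof -
  interpret QQ: pair_prob_space Q Q ..
  obtain F where F: "F > 0" "\<And>x. x \<in> X \<Longrightarrow> \<bar>f x\<bar> \<le> F" by (rule continuous_bounded[OF f]) (rule that)
  obtain G where G: "G > 0" "\<And>x. x \<in> X \<Longrightarrow> \<bar>g x\<bar> \<le> G" by (rule continuous_bounded[OF g]) (rule that)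
  obtain \<kappa> where \<kappa>: "\<kappa> > 0" "\<And>x y. x \<in> X \<Longrightarrow> y \<in> X \<Longrightarrow> \<bar>K x y\<bar> \<le> \<kappa>" by (rule K_bounded) (rule that)
  have [measurable]: "f \<in> borel_measurable Q" "g \<in> borel_measurable Q"
    using f g by (auto intro: measurable_continuous)
  note [measurable] = K_measurable
  have "integrable (Q \<Otimes>\<^sub>M Q) (\<lambda>(x, y). K x y * f y * g x)"
  proof (rule QQ.integrable_const_bound[of _ "\<kappa> * F * G"])
    show "AE p in Q \<Otimes>\<^sub>M Q. norm (case p of (x, y) \<Rightarrow> K x y * f y * g x) \<le> \<kappa> * F * G"
      by (rule AE_I2) (use F G \<kappa> in \<open>auto simp: space_pair_measure space_Q abs_mult intro!: mult_mono\<close>)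
  qed measurable
  then have "(\<integral>y. (\<integral>x. K x y * f y * g x \<partial>Q) \<partial>Q) = (\<integral>x. (\<integral>y. K x y * f y * g x \<partial>Q) \<partial>Q)"
    by (rule QQ.Fubini_integral)
  also have "(\<integral>x. (\<integral>y. K x y * f y * g x \<partial>Q) \<partial>Q) = ip (T f) g"
    by (simp add: ip_def T_def)
  also have "(\<integral>y. (\<integral>x. K x y * f y * g x \<partial>Q) \<partial>Q) = (\<integral>y. f y * (\<integral>x. K y x * g x \<partial>Q) \<partial>Q)"
  proof (rule Bochner_Integration.integral_cong[OF refl])
    fix y assume "y \<in> space Q"
    then have "(\<integral>x. K x y * f y * g x \<partial>Q) = (\<integral>x. f y * (K y x * g x) \<partial>Q)"
      by (intro Bochner_Integration.integral_cong) (auto simp: space_Q K_sym)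
    then show "(\<integral>x. K x y * f y * g x \<partial>Q) = f y * (\<integral>x. K y x * g x \<partial>Q)" by simp
  qed
  finally show ?thesis by (simp add: ip_def T_def)
qed

lemma ip_uniform_limit:
  assumes F: "\<And>n. continuous_on X (F n)" and lim: "uniform_limit X F f sequentially"
    and h: "continuous_on X h"
  shows "(\<lambda>n. ip (F n) h) \<longlonglongrightarrow> ip f h"
proof (rule LIMSEQ_I)
  fix e :: real assume "e > 0"
  have f: "continuous_on X f"
    by (rule uniform_limit_theorem[OF _ lim]) (auto simp: F)
  define s where "s = sqrt (ip h h) + 1"
  have s: "s > 0" using ip_nonneg[of h] by (simp add: s_def add_nonneg_pos)
  have "e / (2 * s) > 0" using \<open>e > 0\<close> s by simp
  from uniform_limitD[OF lim this] obtain N where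
    N: "\<And>n x. n \<ge> N \<Longrightarrow> x \<in> X \<Longrightarrow> \<bar>F n x - f x\<bar> < e / (2 * s)"
    by (auto simp: eventually_sequentially dist_real_def)
  have "norm (ip (F n) h - ip f h) < e" if "n \<ge> N" for n
  proof -
    have "ip (F n) h - ip f h = ip h (\<lambda>x. F n x - f x)"
      using ip_add_left[OF F[of n] f h, of "-1"] by (simp add: ip_commute)
    also have "\<bar>\<dots>\<bar> \<le> e / (2 * s) * sqrt (ip h h)"
      using N[OF that] by (intro ip_bound h continuous_intros F f) (simp add: less_imp_le)
    also have "\<dots> \<le> e / (2 * s) * s"
      using \<open>e > 0\<close> s by (intro mult_left_mono) (auto simp: s_def)
    also have "\<dots> < e" using s \<open>e > 0\<close> by (simp add: field_simps)
    finally show ?thesis by simp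
  qed
  then show "\<exists>N. \<forall>n\<ge>N. norm (ip (F n) h - ip f h) < e" by blast
qed

lemma T_bounded:
  obtains \<kappa> where "\<kappa> > 0" "\<And>f x. continuous_on X f \<Longrightarrow> x \<in> X \<Longrightarrow> \<bar>T f x\<bar> \<le> \<kappa> * sqrt (ip f f)"
    "\<And>f. continuous_on X f \<Longrightarrow> ip (T f) (T f) \<le> \<kappa>\<^sup>2 * ip f f"
proof -
  obtain \<kappa> where \<kappa>: "\<kappa> > 0" "\<And>x y. x \<in> X \<Longrightarrow> y \<in> X \<Longrightarrow> \<bar>K x y\<bar> \<le> \<kappa>" by (rule K_bounded) (rule that)
  have 1: "\<bar>T f x\<bar> \<le> \<kappa> * sqrt (ip f f)" if "continuous_on X f" "x \<in> X" for f x
    unfolding T_eq_ip using that \<kappa>(2) by (intro ip_bound K_cont1) auto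
  have 2: "ip (T f) (T f) \<le> \<kappa>\<^sup>2 * ip f f" if f: "continuous_on X f" for f
  proof -
    have "ip (T f) (T f) \<le> (\<integral>x. \<kappa>\<^sup>2 * ip f f \<partial>Q)"
      unfolding ip_def[of "T f"]
    proof (rule integral_mono)
      show "integrable Q (\<lambda>x. T f x * T f x)" by (intro integrable_mult T_continuous f)
      show "T f x * T f x \<le> \<kappa>\<^sup>2 * ip f f" if "x \<in> space Q" for x
      proof -
        have "(T f x)\<^sup>2 \<le> (\<kappa> * sqrt (ip f f))\<^sup>2"
          using 1[OF f, of x] that \<kappa>(1) ip_nonneg[of f] by (intro abs_le_square_iff[THEN iffD1]) (auto simp: space_Q)
        also have "\<dots> = \<kappa>\<^sup>2 * ip f f" using ip_nonneg[of f] by (simp add: power_mult_distrib)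
        finally show ?thesis by (simp add: power2_eq_square)
      qed
    qed simp
    then show ?thesis by (simp add: prob_space)
  qed
  show thesis by (rule that[OF \<kappa>(1) 1 2])
qed

end

section \<open>Positivity of the kernel against atoms and densities\<close>

text \<open>Atoms may coincide, whereas \<open>psd\<close> speaks of a set of distinct points; equal
  points are merged by adding their coefficients.\<close>

lemma psd_finite_family:
  fixes K :: "'a \<Rightarrow> 'a \<Rightarrow> real"
  assumes psd: "\<And>F c. finite F \<Longrightarrow> F \<subseteq> X \<Longrightarrow> (\<Sum>x\<in>F. \<Sum>y\<in>F. c x * c y * K x y) \<ge> 0"
    and I: "finite I" and x: "\<And>i. i \<in> I \<Longrightarrow> x i \<in> X"
  shows "(\<Sum>i\<in>I. \<Sum>j\<in>I. c i * c j * K (x i) (x j)) \<ge> 0"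
proof -
  define d where "d y = (\<Sum>i\<in>{i\<in>I. x i = y}. c i)" for y
  have group: "(\<Sum>i\<in>I. c i * h (x i)) = (\<Sum>y\<in>x ` I. d y * h y)" for h
  proof -
    have "(\<Sum>y\<in>x ` I. d y * h y) = (\<Sum>y\<in>x ` I. \<Sum>i\<in>{i\<in>I. x i = y}. c i * h (x i))"
      by (auto simp: d_def sum_distrib_right intro!: sum.cong)
    also have "\<dots> = (\<Sum>i\<in>I. c i * h (x i))"
      by (rule sum.group) (use I in auto)
    finally show ?thesis ..
  qed
  have "(\<Sum>i\<in>I. \<Sum>j\<in>I. c i * c j * K (x i) (x j)) = (\<Sum>i\<in>I. c i * (\<Sum>j\<in>I. c j * K (x i) (x j)))"
    by (simp add: sum_distrib_left mult_ac)
  also have "\<dots> = (\<Sum>y\<in>x ` I. d y * (\<Sum>z\<in>x ` I. d z * K y z))"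
    unfolding group[of "K _"] by (rule group)
  also have "\<dots> = (\<Sum>y\<in>x ` I. \<Sum>z\<in>x ` I. d y * d z * K y z)"
    by (simp add: sum_distrib_left mult_ac)
  also have "\<dots> \<ge> 0" by (rule psd) (use I x in auto)
  finally show ?thesis .
qed

locale psd_compact_kernel = compact_kernel +
  assumes K_psd: "\<And>F c. finite F \<Longrightarrow> F \<subseteq> X \<Longrightarrow> (\<Sum>x\<in>F. \<Sum>y\<in>F. c x * c y * K x y) \<ge> 0"
begin

text \<open>The quadratic form of \<open>K\<close> at the measure \<open>\<Sum>c\<^sub>i \<delta>\<^bsub>x\<^sub>i\<^esub> + k t g dQ\<close>, up to an error linear in \<open>k\<close>. In the
  induction a further atom \<open>t g(y) \<delta>\<^sub>y\<close> is added and \<open>y\<close> is integrated out. For \<open>t = 1/k\<close> the error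
  vanishes in the limit.\<close>
lemma psd_discrete_plus_averaged:
  fixes g :: "'a \<Rightarrow> real"
  assumes g: "continuous_on X g"
  defines "D \<equiv> (\<integral>y. g y * g y * K y y \<partial>Q) - ip g (T g)"
  assumes "\<And>i. i < (s::nat) \<Longrightarrow> x i \<in> X"
  shows "(\<Sum>i<s. \<Sum>j<s. c i * c j * K (x i) (x j)) + 2 * (real k * t) * (\<Sum>i<s. c i * T g (x i))
     + (real k * t)\<^sup>2 * ip g (T g) + real k * t\<^sup>2 * D \<ge> 0"
  using assms(3)
proof (induction k arbitrary: s x c)
  case 0
  have "(\<Sum>i\<in>{..<s}. \<Sum>j\<in>{..<s}. c i * c j * K (x i) (x j)) \<ge> 0"
    by (rule psd_finite_family[OF K_psd]) (use 0 in auto)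
  then show ?case by simp
next
  case (Suc k)
  define q0 where "q0 = (\<Sum>i<s. \<Sum>j<s. c i * c j * K (x i) (x j))"
  define L where "L = (\<Sum>i<s. c i * T g (x i))"
  define G where "G = ip g (T g)"
  define f where "f y = (\<Sum>i<s. c i * K (x i) y)" for y
  define a where "a = real k * t"
  define C where "C = q0 + 2 * a * L + a\<^sup>2 * G + real k * t\<^sup>2 * D"
  have f: "continuous_on X f" unfolding f_def using Suc.prems by (intro continuous_intros K_cont1) auto
  have pos: "C + 2 * t * (g y * f y) + t\<^sup>2 * (g y * g y * K y y) + 2 * a * t * (g y * T g y) \<ge> 0"
    if y: "y \<in> X" for y
  proof -
    let ?c = "c(s := t * g y)" and ?x = "x(s := y)"
    have "(\<Sum>i<Suc s. \<Sum>j<Suc s. ?c i * ?c j * K (?x i) (?x j)) =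
       q0 + 2 * t * (g y * f y) + t\<^sup>2 * (g y * g y * K y y)"
    proof -
      have "(\<Sum>j<s. t * g y * c j * K y (x j)) = t * g y * f y"
        using Suc.prems y unfolding f_def sum_distrib_left
        by (intro sum.cong) (auto simp: K_sym[of y])
      moreover have "(\<Sum>i<s. c i * (t * g y) * K (x i) y) = t * g y * f y"
        unfolding f_def sum_distrib_left by (simp add: mult_ac)
      ultimately show ?thesis by (simp add: sum.distrib q0_def power2_eq_square)
    qed
    moreover have "(\<Sum>i<Suc s. ?c i * T g (?x i)) = L + t * g y * T g y"
      by (simp add: L_def)
    moreover have "(\<Sum>i<Suc s. \<Sum>j<Suc s. ?c i * ?c j * K (?x i) (?x j)) + 2 * a * (\<Sum>i<Suc s. ?c i * T g (?x i))
       + a\<^sup>2 * G + real k * t\<^sup>2 * D \<ge> 0"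
      unfolding a_def G_def by (rule Suc.IH) (use Suc.prems y in auto)
    ultimately show ?thesis by (simp add: C_def algebra_simps)
  qed
  have "0 \<le> (\<integral>y. C + 2 * t * (g y * f y) + t\<^sup>2 * (g y * g y * K y y) + 2 * a * t * (g y * T g y) \<partial>Q)"
    by (rule integral_nonneg_AE, rule AE_I2) (use pos in \<open>simp add: space_Q\<close>)
  \<comment> \<open>The new atom also meets itself, and this square integrates to the diagonal
    integral \<open>D + G\<close> where the averaged form has \<open>G\<close>. Each atom thus
    leaves an excess \<open>t\<^sup>2 * D\<close>.\<close>
  also have "\<dots> = C + 2 * t * ip g f + t\<^sup>2 * (D + G) + 2 * a * t * G"
  proof -
    have "integrable Q (\<lambda>y. g y * f y)" "integrable Q (\<lambda>y. g y * g y * K y y)" "integrable Q (\<lambda>y. g y * T g y)"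
      by (intro integrable_mult integrable_continuous continuous_intros g f T_continuous K_cont_diag)+
    then show ?thesis by (simp add: ip_def D_def G_def prob_space)
  qed
  also have "ip g f = L"
  proof -
    have "ip g f = (\<Sum>i<s. c i * ip (K (x i)) g)"
      unfolding f_def using Suc.prems
      by (subst ip_commute, subst ip_sum_left) (auto intro: K_cont1 g)
    then show ?thesis by (simp add: L_def T_eq_ip ip_commute)
  qed
  finally show ?case
    unfolding q0_def[symmetric] L_def[symmetric] G_def[symmetric]
    by (simp add: C_def a_def power2_eq_square algebra_simps)
qed

text \<open>The form needed for the expansion: eigenfunctions enter as the density \<open>g\<close>
  and the evaluation point as an atom.\<close>

lemma psd_mixed:
  assumes g: "continuous_on X g" and x: "\<And>i. i < (s::nat) \<Longrightarrow> x i \<in> X"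
  shows "(\<Sum>i<s. \<Sum>j<s. c i * c j * K (x i) (x j)) + 2 * (\<Sum>i<s. c i * T g (x i)) + ip g (T g) \<ge> 0"
    (is "?S \<ge> 0")
proof (rule LIMSEQ_le_const)
  define D where "D = (\<integral>y. g y * g y * K y y \<partial>Q) - ip g (T g)"
  have "(\<lambda>n. ?S + D * (1 / real (Suc n))) \<longlonglongrightarrow> ?S + D * 0"
    by (intro tendsto_intros LIMSEQ_Suc lim_1_over_n)
  then show "(\<lambda>n. ?S + D * (1 / real (Suc n))) \<longlonglongrightarrow> ?S" by simp
  have "0 \<le> ?S + D * (1 / real (Suc n))" for n
    using psd_discrete_plus_averaged[OF g x, where c = c and k = "Suc n" and t = "1 / real (Suc n)"]
    unfolding D_def by (simp add: power2_eq_square del: of_nat_Suc)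
  then show "\<exists>N. \<forall>n\<ge>N. 0 \<le> ?S + D * (1 / real (Suc n))" by blast
qed

end

section \<open>Expansion of the kernel in eigenfunctions\<close>

text \<open>Indices start at \<open>0\<close> and run through all naturals; a finite list is
  continued by zero pairs. The factor \<open>l i\<close> makes the orthonormality relations true for
  these as well. Completeness concerns functions orthogonal to every \<open>p i\<close>, whatever
  the sign of the eigenvalue \<open>a\<close>.\<close>

locale mercer_system = psd_compact_kernel +
  fixes l :: "nat \<Rightarrow> real" and p :: "nat \<Rightarrow> 'a \<Rightarrow> real"
  assumes l_nonneg: "\<And>i. l i \<ge> 0"
    and p_cont: "\<And>i. continuous_on X (p i)"
    and p_eigen: "\<And>i x. x \<in> X \<Longrightarrow> T (p i) x = l i * p i x"
    and p_orth: "\<And>i j. l i * ip (p i) (p j) = (if i = j then l i else 0)"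
    and p_complete: "\<And>f a x. continuous_on X f \<Longrightarrow> (\<And>i. ip f (p i) = 0) \<Longrightarrow>
      (\<And>x. x \<in> X \<Longrightarrow> T f x = a * f x) \<Longrightarrow> x \<in> X \<Longrightarrow> f x = 0"
begin

text \<open>Positivity is tested at the point mass at \<open>x\<close> with its components along the
  \<open>p i\<close> subtracted. With \<open>S\<close> the sum on the left, the three terms of the
  form are \<open>K x x\<close>, \<open>- 2 * S\<close> and \<open>S\<close>.\<close>

lemma eigen_sum_le_diagonal:
  assumes x: "x \<in> X" and I: "finite I"
  shows "(\<Sum>i\<in>I. l i * (p i x)\<^sup>2) \<le> K x x"
proof -
  define g where "g y = (\<Sum>i\<in>I. - p i x * p i y)" for y
  define S where "S = (\<Sum>i\<in>I. l i * (p i x)\<^sup>2)"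
  have g: "continuous_on X g" unfolding g_def by (intro continuous_intros p_cont)
  have Tg: "T g y = (\<Sum>i\<in>I. - p i x * (l i * p i y))" if "y \<in> X" for y
    unfolding g_def T_eq_ip using that
    by (subst ip_sum_left) (auto intro: p_cont K_cont1 simp: T_eq_ip[symmetric] p_eigen)
  have "T g x = - S" unfolding Tg[OF x] S_def
    by (simp add: sum_negf power2_eq_square mult_ac)
  moreover have "ip g (T g) = S"
  proof -
    have "ip g (T g) = ip g (\<lambda>y. \<Sum>i\<in>I. (- p i x * l i) * p i y)"
      by (rule ip_cong) (auto simp: Tg mult_ac)
    also have "\<dots> = (\<Sum>i\<in>I. (- p i x * l i) * ip (p i) g)"
      by (subst ip_commute, subst ip_sum_left) (auto intro: p_cont g)
    also have "\<dots> = (\<Sum>i\<in>I. (- p i x * l i) * (\<Sum>j\<in>I. - p j x * ip (p j) (p i)))"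
      unfolding g_def by (subst (1) ip_commute, subst ip_sum_left) (auto intro: p_cont)
    also have "\<dots> = (\<Sum>i\<in>I. \<Sum>j\<in>I. p i x * p j x * (l i * ip (p i) (p j)))"
      by (simp add: sum_distrib_left mult_ac ip_commute)
    also have "\<dots> = S"
    proof -
      have "(\<Sum>j\<in>I. p i x * p j x * (if i = j then l i else 0)) = l i * (p i x)\<^sup>2" if "i \<in> I" for i
      proof -
        have "(\<Sum>j\<in>I. p i x * p j x * (if i = j then l i else 0)) =
            (\<Sum>j\<in>I. if i = j then l i * (p i x)\<^sup>2 else 0)"
          by (rule sum.cong) (auto simp: power2_eq_square)
        then show ?thesis using I that by (simp add: sum.delta)
      qed
      then show ?thesis unfolding p_orth S_def by (rule sum.cong[OF refl])
    qed
    finally show ?thesis .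
  qed
  moreover have "(\<Sum>i<(1::nat). \<Sum>j<(1::nat). 1 * 1 * K x x) + 2 * (\<Sum>i<(1::nat). 1 * T g x) + ip g (T g) \<ge> 0"
    using psd_mixed[OF g, of 1 "\<lambda>_. x" "\<lambda>_. 1"] x by simp
  ultimately show ?thesis by (simp add: S_def)
qed

definition perp :: "('a \<Rightarrow> real) set" where
  "perp = {f. continuous_on X f \<and> (\<forall>i. ip f (p i) = 0)}"

lemma perp_T: "f \<in> perp \<Longrightarrow> T f \<in> perp"
proof -
  assume "f \<in> perp"
  then have f: "continuous_on X f" "\<And>i. ip f (p i) = 0" by (auto simp: perp_def)
  have "ip (T f) (p i) = 0" for i
  proof -
    have "ip (T f) (p i) = ip f (\<lambda>x. l i * p i x)"
      unfolding T_symmetric[OF f(1) p_cont] by (rule ip_cong) (auto simp: p_eigen)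
    also have "\<dots> = l i * ip f (p i)"
      using ip_scale[of "l i" "p i" f] by (simp add: ip_commute)
    finally show ?thesis using f(2) by simp
  qed
  then show ?thesis using T_continuous[OF f(1)] by (simp add: perp_def)
qed

lemma perp_add: "f \<in> perp \<Longrightarrow> g \<in> perp \<Longrightarrow> (\<lambda>x. f x + c * g x) \<in> perp"
  unfolding perp_def by (auto intro!: continuous_intros simp: ip_add_left p_cont)

text \<open>Among the \<open>f\<close> orthogonal to all eigenfunctions, a sequence maximising \<open>\<parallel>T f\<parallel>\<^sup>2\<close> on the unit ball
  has by Arzela--Ascoli images converging uniformly to some \<open>g\<close> with \<open>T (T g) = A g\<close>, where \<open>A\<close>
  is the supremum. If \<open>A > 0\<close>, then \<open>T g + \<surd>A g\<close> is a \<open>\<surd>A\<close>-eigenfunction, hence \<open>0\<close>, so \<open>g\<close> is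
  a \<open>-\<surd>A\<close>-eigenfunction, hence also \<open>0\<close>, although \<open>\<parallel>g\<parallel>\<^sup>2 = A\<close>.\<close>
lemma perp_eq_0:
  assumes "f \<in> perp" "x \<in> X" shows "f x = 0"
proof -
  define N where "N f = ip f f" for f
  obtain \<kappa> where \<kappa>: "\<kappa> > 0"
    and Tsup: "\<And>f x. continuous_on X f \<Longrightarrow> x \<in> X \<Longrightarrow> \<bar>T f x\<bar> \<le> \<kappa> * sqrt (ip f f)"
    and "\<And>f. continuous_on X f \<Longrightarrow> ip (T f) (T f) \<le> \<kappa>\<^sup>2 * ip f f"
    by (rule T_bounded) (rule that)
  then have TN: "\<And>f. continuous_on X f \<Longrightarrow> N (T f) \<le> \<kappa>\<^sup>2 * N f"
    by (simp add: N_def)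
  have perpD: "continuous_on X f" "ip f (p i) = 0" if "f \<in> perp" for f i
    using that by (auto simp: perp_def)
  have N0: "N f \<ge> 0" for f unfolding N_def by (rule ip_nonneg)
  define B where "B = {f \<in> perp. N f \<le> 1}"
  define A where "A = (SUP f\<in>B. N (T f))"
  have bdd: "bdd_above ((\<lambda>f. N (T f)) ` B)"
  proof (rule bdd_aboveI2)
    fix f assume "f \<in> B"
    then have "N (T f) \<le> \<kappa>\<^sup>2 * N f" "\<kappa>\<^sup>2 * N f \<le> \<kappa>\<^sup>2 * 1"
      using mult_left_mono[of "N f" 1 "\<kappa>\<^sup>2"] TN[OF perpD(1), of f] by (auto simp: B_def)
    then show "N (T f) \<le> \<kappa>\<^sup>2" by simp
  qed
  have zero: "(\<lambda>_. 0) \<in> B" by (auto simp: B_def perp_def N_def ip_def)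
  have upper: "N (T f) \<le> A" if "f \<in> B" for f
    unfolding A_def by (rule cSUP_upper[OF that bdd])
  have A0: "A \<ge> 0" using upper[OF zero] N0 order_trans by blast
  have scaled: "N (T f) \<le> A * N f" if f: "f \<in> perp" for f
  proof (cases "N f = 0")
    case True
    then show ?thesis using TN[OF perpD(1)[OF f]] by simp
  next
    case False
    then have pos: "N f > 0" using N0[of f] by simp
    define c where "c = 1 / sqrt (N f)"
    have c2: "c * c = 1 / N f" using pos by (simp add: c_def)
    have sc: "N (\<lambda>x. c * h x) = c * c * N h" for h
      unfolding N_def using ip_commute[of h "\<lambda>x. c * h x"] by (simp add: ip_scale)
    have "(\<lambda>x. c * f x) \<in> perp"
      using perpD[OF f] by (auto simp: perp_def ip_scale intro!: continuous_intros)
    moreover have "N (\<lambda>x. c * f x) = 1" using pos by (simp add: sc c2)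
    ultimately have "N (T (\<lambda>x. c * f x)) \<le> A" by (intro upper) (simp add: B_def)
    moreover have "T (\<lambda>x. c * f x) = (\<lambda>x. c * T f x)" by (rule ext) (rule T_scale)
    ultimately have "N (T f) / N f \<le> A" by (simp add: sc c2)
    then show ?thesis using pos by (simp add: field_simps)
  qed
  have "A = 0"
  proof (rule ccontr)
    assume "A \<noteq> 0"
    then have Apos: "A > 0" using A0 by simp
    have "\<exists>f\<in>B. N (T f) > A - 1 / real (Suc k)" for k
      using less_cSUP_iff[OF _ bdd, of "A - 1 / real (Suc k)"] zero unfolding A_def[symmetric] by auto
    then obtain f where fB: "\<And>k. f k \<in> B" and fA: "\<And>k. N (T (f k)) > A - 1 / real (Suc k)"
      by metis
    have fp: "f k \<in> perp" and f1: "N (f k) \<le> 1" for k using fB by (auto simp: B_def)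
    note fc = perpD(1)[OF fp]
    have sq1: "sqrt (ip (f k) (f k)) \<le> 1" for k using f1[of k] by (simp add: N_def)
    obtain g and s :: "nat \<Rightarrow> nat" where g: "continuous_on X g" and s: "strict_mono s"
      and lim: "\<And>e. 0 < e \<Longrightarrow> \<exists>N. \<forall>n x. n \<ge> N \<and> x \<in> X \<longrightarrow> norm (T (f (s n)) x - g x) < e"
    proof (rule Arzela_Ascoli[OF compact_X, of "\<lambda>k. T (f k)" \<kappa>])
      show "norm (T (f n) x) \<le> \<kappa>" if "x \<in> X" for n x
      proof -
        have "\<bar>T (f n) x\<bar> \<le> \<kappa> * sqrt (ip (f n) (f n))" by (rule Tsup[OF fc that])
        also have "\<dots> \<le> \<kappa> * 1" by (rule mult_left_mono[OF sq1]) (use \<kappa> in simp)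
        finally show ?thesis by simp
      qed
      fix x and e :: real assume x: "x \<in> X" and e: "0 < e"
      obtain d where d: "d > 0"
        "\<And>x x' y. x \<in> X \<Longrightarrow> x' \<in> X \<Longrightarrow> y \<in> X \<Longrightarrow> dist x x' < d \<Longrightarrow> \<bar>K x y - K x' y\<bar> \<le> e / 2"
        using K_equicontinuous[of "e / 2"] e by auto
      show "\<exists>d>0. \<forall>n y. y \<in> X \<and> norm (x - y) < d \<longrightarrow> norm (T (f n) x - T (f n) y) < e"
      proof (intro exI[of _ d] conjI d(1) allI impI)
        fix n y assume y: "y \<in> X \<and> norm (x - y) < d"
        have "\<bar>T (f n) x - T (f n) y\<bar> \<le> e / 2 * sqrt (ip (f n) (f n))"
          using y d(2) x by (intro T_diff_bound fc) (auto simp: dist_norm)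
        also have "\<dots> \<le> e / 2 * 1" using sq1[of n] e by (intro mult_left_mono) auto
        also have "\<dots> < e" using e by simp
        finally show "norm (T (f n) x - T (f n) y) < e" by simp
      qed
    qed (rule that)
    define G where "G n = T (f (s n))" for n
    have Gp: "G n \<in> perp" for n unfolding G_def by (intro perp_T fp)
    note Gc = perpD(1)[OF Gp]
    have ul: "uniform_limit X G g sequentially"
      unfolding uniform_limit_iff eventually_sequentially G_def dist_norm using lim by metis
    have ip_lim: "(\<lambda>n. ip (G n) h) \<longlonglongrightarrow> ip g h" if "continuous_on X h" for h
      by (rule ip_uniform_limit[OF Gc ul that])
    have gp: "g \<in> perp"
      using LIMSEQ_unique[OF ip_lim[OF p_cont]] perpD(2)[OF Gp] g by (auto simp: perp_def)
    have NGA: "(\<lambda>n. N (G n)) \<longlonglongrightarrow> A"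
    proof (rule tendsto_sandwich)
      show "\<forall>\<^sub>F n in sequentially. A - 1 / real (Suc (s n)) \<le> N (G n)"
        using fA by (auto simp: G_def less_imp_le)
      show "\<forall>\<^sub>F n in sequentially. N (G n) \<le> A" using upper fB by (simp add: G_def)
      have "(\<lambda>n. A - 1 / real (Suc n)) \<longlonglongrightarrow> A - 0"
        by (intro tendsto_intros LIMSEQ_Suc lim_1_over_n)
      from LIMSEQ_subseq_LIMSEQ[OF this s] show "(\<lambda>n. A - 1 / real (Suc (s n))) \<longlonglongrightarrow> A"
        by (simp add: o_def)
    qed simp
    have Ng: "N g = A"
    proof -
      have "uniform_limit X (\<lambda>n x. G n x * G n x) (\<lambda>x. g x * g x) sequentially"
        using compact_imp_bounded[OF compact_continuous_image[OF g compact_X]]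
        by (intro uniform_lim_mult ul)
      from ip_uniform_limit[OF _ this, of "\<lambda>_. 1"]
      have "(\<lambda>n. N (G n)) \<longlonglongrightarrow> N g"
        using Gc by (simp add: N_def ip_def continuous_on_mult)
      from LIMSEQ_unique[OF this NGA] show ?thesis .
    qed
    have TTg: "T (T g) x = A * g x" if x: "x \<in> X" for x
    proof -
      \<comment> \<open>Near-maximisers are almost eigenfunctions of the square of \<open>T\<close>:
        expanding the norm, with \<open>N (T (G n)) \<le> A * N (G n)\<close> and
        \<open>N (f (s n)) \<le> 1\<close>, leaves at most \<open>A * (A - N (G n))\<close>, which
        tends to \<open>0\<close>.\<close>
      define d where "d n y = T (G n) y + (- A) * f (s n) y" for n y
      have dc: "continuous_on X (d n)" for n unfolding d_def
        by (intro continuous_intros T_continuous Gc fc)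
      have Nd: "N (d n) \<le> A * (A - N (G n))" for n
      proof -
        have tc: "continuous_on X (T (G n))" by (intro T_continuous Gc)
        have 1: "ip (T (G n)) (f (s n)) = N (G n)"
          unfolding N_def T_symmetric[OF Gc fc] by (simp add: G_def)
        have "N (d n) = N (T (G n)) + 2 * (- A) * ip (T (G n)) (f (s n)) + A * A * N (f (s n))"
        proof -
          have Nd1: "N (d n) = ip (T (G n)) (d n) + (- A) * ip (f (s n)) (d n)"
            unfolding N_def by (subst (1) d_def[abs_def]) (rule ip_add_left[OF tc fc dc])
          have e: "ip h (d n) = ip h (T (G n)) + (- A) * ip h (f (s n))" if "continuous_on X h" for h
            unfolding d_def by (rule ip_add_right[OF tc fc that])
          have "ip (f (s n)) (T (G n)) = ip (T (G n)) (f (s n))" by (rule ip_commute)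
          then show ?thesis unfolding Nd1 e[OF tc] e[OF fc] by (simp add: N_def algebra_simps)
        qed
        also have "\<dots> \<le> A * N (G n) - 2 * A * N (G n) + A * A * 1"
          using scaled[OF Gp[of n]] mult_left_mono[OF f1[of "s n"], of "A * A"] unfolding 1 by simp
        finally show ?thesis by (simp add: algebra_simps)
      qed
      have Nd0: "(\<lambda>n. N (d n)) \<longlonglongrightarrow> 0"
      proof (rule tendsto_sandwich[OF _ _ tendsto_const])
        show "\<forall>\<^sub>F n in sequentially. 0 \<le> N (d n)" by (simp add: N0)
        show "\<forall>\<^sub>F n in sequentially. N (d n) \<le> A * (A - N (G n))" by (simp add: Nd)
        show "(\<lambda>n. A * (A - N (G n))) \<longlonglongrightarrow> 0"
          using tendsto_mult[OF tendsto_const[of A] tendsto_diff[OF tendsto_const[of A] NGA]] by simp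
      qed
      have "(\<lambda>n. \<kappa> * sqrt (N (d n))) \<longlonglongrightarrow> \<kappa> * sqrt 0"
        by (intro tendsto_intros Nd0)
      then have k0: "(\<lambda>n. \<kappa> * sqrt (N (d n))) \<longlonglongrightarrow> 0" by simp
      \<comment> \<open>The \<open>f (s n)\<close> need not converge, only their images do. One more
        application of \<open>T\<close> replaces them by these images and turns convergence in norm
        into pointwise convergence.\<close>
      have d0: "(\<lambda>n. T (d n) x) \<longlonglongrightarrow> 0"
        by (rule Lim_null_comparison[OF always_eventually k0])
           (use Tsup[OF dc x] in \<open>simp add: N_def\<close>)
      have Tdn: "T (d n) x = ip (G n) (T (K x)) - A * G n x" for n
      proof -
        have "T (d n) x = T (T (G n)) x + (- A) * T (f (s n)) x"
          unfolding d_def by (rule T_add[OF T_continuous[OF Gc] fc x])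
        also have "T (f (s n)) x = G n x" by (simp only: G_def)
        also have "T (T (G n)) x = ip (G n) (T (K x))"
          unfolding T_eq_ip[of "T (G n)"] by (rule T_symmetric[OF Gc K_cont1[OF x]])
        finally show ?thesis by simp
      qed
      have "(\<lambda>n. T (d n) x) \<longlonglongrightarrow> ip g (T (K x)) - A * g x"
        unfolding Tdn
        by (rule tendsto_diff[OF ip_lim[OF T_continuous[OF K_cont1[OF x]]]
              tendsto_mult[OF tendsto_const tendsto_uniform_limitI[OF ul x]]])
      from LIMSEQ_unique[OF this d0] have "ip g (T (K x)) - A * g x = 0" .
      moreover have "ip g (T (K x)) = T (T g) x"
        unfolding T_eq_ip[of "T g"] by (rule T_symmetric[OF g K_cont1[OF x], symmetric])
      ultimately show ?thesis by simp
    qed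
    define a where "a = sqrt A"
    have a: "a * a = A" using A0 by (simp add: a_def)
    define h where "h x = T g x + a * g x" for x
    have hp: "h \<in> perp" unfolding h_def by (intro perp_add perp_T gp)
    have "T h x = a * h x" if x: "x \<in> X" for x
    proof -
      have "T h x = T (T g) x + a * T g x"
        unfolding h_def by (rule T_add[OF T_continuous[OF g] g x])
      then show ?thesis using a by (simp add: TTg[OF x] h_def algebra_simps)
    qed
    then have h0: "h x = 0" if "x \<in> X" for x
      using p_complete[of h a x] perpD[OF hp] that by blast
    have "T g x = (- a) * g x" if "x \<in> X" for x using h0[OF that] by (simp add: h_def)
    then have "g x = 0" if "x \<in> X" for x
      using p_complete[of g "- a" x] perpD[OF gp] that by blast
    then have "N g = ip (\<lambda>_. 0) (\<lambda>_. 0)" unfolding N_def by (intro ip_cong) auto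
    then show False using Ng Apos by (simp add: ip_def)
  qed
  then have "N (T f) = 0" using scaled[OF assms(1)] N0[of "T f"] by simp
  \<comment> \<open>With \<open>A = 0\<close> the function is annihilated by \<open>T\<close>, so
    completeness applies to it with eigenvalue \<open>0\<close>.\<close>
  then have "T f x = 0 * f x" if "x \<in> X" for x
    using ip_self_eq_0[OF T_continuous[OF perpD(1)[OF assms(1)]]] that by (simp add: N_def)
  then show ?thesis using p_complete[of f 0 x] perpD[OF assms(1)] assms(2) by blast
qed

text \<open>For fixed \<open>x\<close>, the difference of the two sides is continuous in \<open>y\<close> and orthogonal to all
  eigenfunctions.\<close>
theorem mercer:
  assumes x: "x \<in> X" and y: "y \<in> X"
  shows "(\<lambda>i. l i * p i x * p i y) sums K x y"
proof -
  have summ: "summable (\<lambda>i. l i * (p i x)\<^sup>2)" "suminf (\<lambda>i. l i * (p i x)\<^sup>2) \<le> K x x" if "x \<in> X" for x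
  proof -
    have "sum (\<lambda>i. l i * (p i x)\<^sup>2) {..<n} \<le> K x x" for n
      by (rule eigen_sum_le_diagonal[OF that]) simp
    then show "summable (\<lambda>i. l i * (p i x)\<^sup>2)"
      by (intro bounded_imp_summable[where B = "K x x"] mult_nonneg_nonneg l_nonneg)
         (auto simp: lessThan_Suc_atMost[symmetric] simp del: sum.lessThan_Suc)
    then show "suminf (\<lambda>i. l i * (p i x)\<^sup>2) \<le> K x x"
      using eigen_sum_le_diagonal[OF that] by (intro suminf_le_const) auto
  qed
  obtain \<kappa> where \<kappa>: "\<kappa> > 0" "\<And>x y. x \<in> X \<Longrightarrow> y \<in> X \<Longrightarrow> \<bar>K x y\<bar> \<le> \<kappa>" by (rule K_bounded) (rule that)
  define F where "F n y = (\<Sum>i<n. (l i * p i x) * p i y)" for n y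
  define f where "f y = (\<Sum>i. l i * p i x * p i y)" for y
  have Fc: "continuous_on X (F n)" for n unfolding F_def by (intro continuous_intros p_cont)
  \<comment> \<open>The weight \<open>e\<close> compensates an imbalance: the tail of the series at
    the fixed \<open>x\<close> is small, while at \<open>y\<close> it is merely bounded, by
    \<open>\<kappa>\<close> for all \<open>y\<close>. A small weight on the second part makes the
    remainder small uniformly in \<open>y\<close>.\<close>
  have weighted: "\<bar>l i * p i x * p i y\<bar> \<le> (l i * (p i x)\<^sup>2) / (2 * e) + e / 2 * (l i * (p i y)\<^sup>2)"
    if "e > 0" for e i y
  proof -
    have "2 * (\<bar>p i x\<bar> * (e * \<bar>p i y\<bar>)) \<le> (p i x)\<^sup>2 + (e * p i y)\<^sup>2"
      using sum_squares_bound[of "\<bar>p i x\<bar>" "e * \<bar>p i y\<bar>"] by (simp add: power_mult_distrib)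
    then have "\<bar>p i x\<bar> * \<bar>p i y\<bar> \<le> (p i x)\<^sup>2 / (2 * e) + e / 2 * (p i y)\<^sup>2"
      using that by (simp add: field_simps power2_eq_square)
    from mult_left_mono[OF this l_nonneg[of i]] show ?thesis
      using l_nonneg[of i] by (simp add: abs_mult algebra_simps)
  qed
  have abs_summ: "summable (\<lambda>i. \<bar>l i * p i x * p i y\<bar>)" if y: "y \<in> X" for y
  proof (rule summable_comparison_test'[where N = 0])
    show "summable (\<lambda>i. l i * (p i x)\<^sup>2 / (2 * 1) + 1 / 2 * (l i * (p i y)\<^sup>2))"
      by (intro summable_add summable_divide summable_mult summ x y)
    show "norm \<bar>l i * p i x * p i y\<bar> \<le> l i * (p i x)\<^sup>2 / (2 * 1) + 1 / 2 * (l i * (p i y)\<^sup>2)" for i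
      using weighted[of 1 i y] by (simp only: real_norm_def abs_idempotent)
  qed
  have ul: "uniform_limit X F f sequentially"
  proof (rule uniform_limitI)
    fix e :: real assume e: "e > 0"
    \<comment> \<open>The part at \<open>y\<close> then contributes at most
      \<open>d / 2 * \<kappa> = e / 4\<close>, and the part at \<open>x\<close> less than
      \<open>e / 2\<close> once \<open>tl n < e * d\<close>.\<close>
    define d where "d = e / (2 * \<kappa>)"
    have d: "d > 0" using e \<kappa> by (simp add: d_def)
    define tl where "tl n = (\<Sum>i. l (i + n) * (p (i + n) x)\<^sup>2)" for n
    have "tl \<longlonglongrightarrow> 0" unfolding tl_def by (rule suminf_exist_split2[OF summ(1)[OF x]])
    moreover have "e * d > 0" using e d by simp
    ultimately have "\<forall>\<^sub>F n in sequentially. tl n < e * d" by (rule order_tendstoD)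
    then show "\<forall>\<^sub>F n in sequentially. \<forall>y\<in>X. dist (F n y) (f y) < e"
    proof eventually_elim
      case (elim n)
      show ?case
      proof
        fix y assume y: "y \<in> X"
        let ?t = "\<lambda>i. l i * p i x * p i y"
        have s: "summable ?t" using abs_summ[OF y] by (rule summable_rabs_cancel)
        have sn: "summable (\<lambda>i. \<bar>?t (i + n)\<bar>)" using abs_summ[OF y] summable_iff_shift[of "\<lambda>i. \<bar>?t i\<bar>" n] by blast
        have sx: "summable (\<lambda>i. l (i + n) * (p (i + n) x)\<^sup>2)" using summ(1)[OF x] summable_iff_shift[of "\<lambda>i. l i * (p i x)\<^sup>2" n] by blast
        have sy: "summable (\<lambda>i. l (i + n) * (p (i + n) y)\<^sup>2)" using summ(1)[OF y] summable_iff_shift[of "\<lambda>i. l i * (p i y)\<^sup>2" n] by blast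
        have "f y - F n y = (\<Sum>i. ?t (i + n))"
          using suminf_split_initial_segment[OF s, of n] by (simp add: f_def F_def)
        then have "\<bar>F n y - f y\<bar> = \<bar>\<Sum>i. ?t (i + n)\<bar>" by (simp add: abs_minus_commute)
        also have "\<dots> \<le> (\<Sum>i. \<bar>?t (i + n)\<bar>)" by (rule summable_rabs[OF sn])
        also have "\<dots> \<le> (\<Sum>i. (l (i + n) * (p (i + n) x)\<^sup>2) / (2 * d) + d / 2 * (l (i + n) * (p (i + n) y)\<^sup>2))"
          by (intro suminf_le weighted d sn summable_add summable_divide summable_mult sx sy)
        also have "\<dots> = tl n / (2 * d) + d / 2 * (\<Sum>i. l (i + n) * (p (i + n) y)\<^sup>2)"
          unfolding tl_def
          by (intro sums_unique[symmetric] sums_add sums_divide sums_mult summable_sums sx sy)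
        also have "(\<Sum>i. l (i + n) * (p (i + n) y)\<^sup>2) \<le> \<kappa>"
        proof -
          have "(\<Sum>i. l (i + n) * (p (i + n) y)\<^sup>2) \<le> (\<Sum>i. l i * (p i y)\<^sup>2)"
            using suminf_split_initial_segment[OF summ(1)[OF y], of n]
              sum_nonneg[of "{..<n}" "\<lambda>i. l i * (p i y)\<^sup>2"] l_nonneg by simp
          also have "\<dots> \<le> \<kappa>" using summ(2)[OF y] \<kappa>(2)[OF y y] by linarith
          finally show ?thesis .
        qed
        then have "tl n / (2 * d) + d / 2 * (\<Sum>i. l (i + n) * (p (i + n) y)\<^sup>2) \<le> tl n / (2 * d) + d / 2 * \<kappa>"
          using d by (intro add_left_mono mult_left_mono) auto
        also have "\<dots> < e / 2 + e / 2"
        proof (rule add_less_le_mono)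
          show "tl n / (2 * d) < e / 2" using elim d by (simp add: field_simps)
          show "d / 2 * \<kappa> \<le> e / 2" using \<kappa> e by (simp add: d_def)
        qed
        finally show "dist (F n y) (f y) < e" by (simp add: dist_real_def)
      qed
    qed
  qed
  have fc: "continuous_on X f"
    by (rule uniform_limit_theorem[OF _ ul]) (auto simp: Fc)
  define r where "r y = K x y + (- 1) * f y" for y
  have "ip r (p j) = 0" for j
  proof -
    have "(\<lambda>n. ip (F n) (p j)) \<longlonglongrightarrow> ip f (p j)"
      by (rule ip_uniform_limit[OF Fc ul p_cont])
    moreover have "(\<lambda>n. ip (F n) (p j)) \<longlonglongrightarrow> l j * p j x"
    proof (rule tendsto_eventually)
      show "\<forall>\<^sub>F n in sequentially. ip (F n) (p j) = l j * p j x"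
        using eventually_gt_at_top[of j]
      proof eventually_elim
        case (elim n)
        have "ip (F n) (p j) = (\<Sum>i<n. p i x * (l i * ip (p i) (p j)))"
          unfolding F_def by (subst ip_sum_left) (auto simp: p_cont mult_ac)
        also have "\<dots> = (\<Sum>i<n. if i = j then l j * p j x else 0)"
          unfolding p_orth by (rule sum.cong) auto
        finally show ?case using elim by simp
      qed
    qed
    ultimately have "ip f (p j) = l j * p j x" by (rule LIMSEQ_unique)
    moreover have "ip (K x) (p j) = l j * p j x"
      using p_eigen[OF x, of j] by (simp add: T_eq_ip ip_commute)
    ultimately show ?thesis
      unfolding r_def using ip_add_left[OF K_cont1[OF x] fc p_cont, of "-1" j] by simp
  qed
  then have "r \<in> perp"
    unfolding perp_def r_def using fc K_cont1[OF x] by (auto intro!: continuous_intros)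
  from perp_eq_0[OF this y] have "f y = K x y" by (simp add: r_def)
  then show ?thesis
    unfolding f_def using summable_sums[OF summable_rabs_cancel[OF abs_summ[OF y]]] by simp
qed

section \<open>Gram matrices of random samples\<close>

lemma diagonal_summable: "x \<in> X \<Longrightarrow> summable (\<lambda>i. l (i + m) * (p (i + m) x)\<^sup>2)"
  using sums_summable[OF mercer[of x x]] summable_iff_shift[of "\<lambda>i. l i * p i x * p i x" m]
  by (simp add: power2_eq_square mult.assoc)

lemma gram_singular_values_tail:
  assumes z: "\<And>k. k \<in> {1..n} \<Longrightarrow> z k \<in> X" and N: "1 \<le> N" "N \<le> n"
  shows "(\<Sum>j\<in>{m..<N}. singular_values (gram_submatrix K n N z) ! j)
    \<le> (\<Sum>k<n. (1 / real n) * (\<Sum>i. l (i + m) * (p (i + m) (z (Suc k)))\<^sup>2))"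
proof (rule singular_value_tail_bound)
  \<comment> \<open>Splitting \<open>l i / real n\<close> into two equal square roots writes every
    entry of the Gram matrix as a series of products \<open>b i k * b i q\<close>. The successor
    turns matrix indices, which start at \<open>0\<close>, into sample indices.\<close>
  define b where "b i k = sqrt (l i / real n) * p i (z (Suc k))" for i k
  have bb: "b i k * b i q = 1 / real n * (l i * p i (z (Suc k)) * p i (z (Suc q)))" for i k q
  proof -
    have "b i k * b i q = (sqrt (l i / real n) * sqrt (l i / real n)) * (p i (z (Suc k)) * p i (z (Suc q)))"
      by (simp only: b_def mult_ac)
    then show ?thesis using l_nonneg[of i] by simp
  qed
  show "gram_submatrix K n N z \<in> carrier_mat n N" by (simp add: gram_submatrix_def)
  show "N \<le> n" by (rule N)
  show "(\<lambda>i. b i k * b i q) sums (gram_submatrix K n N z $$ (k, q))" if "k < n" "q < N" for k q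
  proof -
    have "(\<lambda>i. b i k * b i q) sums (1 / real n * K (z (Suc k)) (z (Suc q)))"
      unfolding bb using that N by (intro sums_mult mercer z) auto
    then show ?thesis using that N by (simp add: gram_submatrix_def gram_matrix_def)
  qed
  have "(\<lambda>i. \<Sum>k<n. 1 / real n * (l (i + m) * (p (i + m) (z (Suc k)))\<^sup>2)) sums
     (\<Sum>k<n. 1 / real n * (\<Sum>i. l (i + m) * (p (i + m) (z (Suc k)))\<^sup>2))"
    by (intro sums_sum sums_mult summable_sums diagonal_summable z) auto
  then show "(\<lambda>i. \<Sum>k<n. (b (i + m) k)\<^sup>2) sums
     (\<Sum>k<n. (1 / real n) * (\<Sum>i. l (i + m) * (p (i + m) (z (Suc k)))\<^sup>2))"
    unfolding power2_eq_square bb by (simp add: mult.assoc)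
qed

lemma gram_singular_value_le:
  assumes z: "\<And>k. k \<in> {1..n} \<Longrightarrow> z k \<in> X" and N: "m < N" "N \<le> n"
    and \<kappa>: "\<And>x. x \<in> X \<Longrightarrow> K x x \<le> \<kappa>"
  shows "singular_values (gram_submatrix K n N z) ! m \<le> \<kappa> / real (Suc m)"
proof -
  let ?s = "singular_values (gram_submatrix K n N z)"
  have A: "gram_submatrix K n N z \<in> carrier_mat n N" by (simp add: gram_submatrix_def)
  obtain v :: "nat \<Rightarrow> nat \<Rightarrow> real" where
    dec: "\<And>i j. i \<le> j \<Longrightarrow> j < N \<Longrightarrow> ?s ! j \<le> ?s ! i" and
    nonneg: "\<And>j. j < N \<Longrightarrow> ?s ! j \<ge> 0"
    by (rule singular_values_decomposition[OF A]) (rule that)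
  have "real (Suc m) * ?s ! m = (\<Sum>j<Suc m. ?s ! m)" by simp
  also have "\<dots> \<le> (\<Sum>j<Suc m. ?s ! j)" by (rule sum_mono) (use dec N in auto)
  also have "\<dots> \<le> (\<Sum>j\<in>{0..<N}. ?s ! j)" by (rule sum_mono2) (use N nonneg in auto)
  \<comment> \<open>The tail bound with no eigenpair removed; by Mercer on the diagonal its
    right-hand side is the mean of \<open>K x x\<close> over the sample points.\<close>
  also have "\<dots> \<le> (\<Sum>k<n. (1 / real n) * (\<Sum>i. l (i + 0) * (p (i + 0) (z (Suc k)))\<^sup>2))"
    by (rule gram_singular_values_tail[OF z]) (use N in auto)
  also have "\<dots> \<le> (\<Sum>k<n. (1 / real n) * \<kappa>)"
  proof (rule sum_mono, rule mult_left_mono)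
    fix k assume "k \<in> {..<n}"
    then have zk: "z (Suc k) \<in> X" by (intro z) auto
    from sums_unique[OF mercer[OF zk zk]]
    show "(\<Sum>i. l (i + 0) * (p (i + 0) (z (Suc k)))\<^sup>2) \<le> \<kappa>"
      using \<kappa>[OF zk] by (simp add: power2_eq_square mult.assoc)
  qed simp
  also have "\<dots> = \<kappa>" using N by simp
  finally show ?thesis by (simp add: pos_le_divide_eq mult.commute del: of_nat_Suc)
qed

end

section \<open>Supports of measures and passage to pointwise statements\<close>

text \<open>The complement of the support is a union of open null sets, and by Lindelof's theorem
  countably many of them already cover it.\<close>

lemma AE_in_measure_support:
  fixes P :: "'a::second_countable_topology measure"
  assumes P: "sets P = sets borel"
  shows "AE x in P. x \<in> measure_support P"
proof -
  define F where "F = {U. open U \<and> emeasure P U = 0}"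
  obtain F' where F': "F' \<subseteq> F" "countable F'" "\<Union>F' = \<Union>F"
    using Lindelof[of F] by (auto simp: F_def)
  have "(\<Union>U\<in>F'. U) \<in> null_sets P"
    using F' P by (intro null_sets_UN') (auto simp: F_def null_sets_def)
  then have "AE x in P. x \<notin> \<Union>F" using AE_not_in F'(3) by fastforce
  then show ?thesis
  proof eventually_elim
    case (elim x)
    then show ?case
      by (auto simp: measure_support_def F_def zero_less_iff_neq_zero)
  qed
qed

text \<open>The set where \<open>f\<close> is nonzero is the trace on \<open>X\<close> of an open
  set \<open>V\<close>. If it contained a point of the support, \<open>V\<close> would have positive
  measure, although almost every point lies in \<open>X\<close> and is a zero of
  \<open>f\<close>.\<close>

lemma continuous_AE_eq_0:
  fixes P :: "'a::second_countable_topology measure" and f :: "'a \<Rightarrow> real"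
  assumes P: "sets P = sets borel" and X: "measure_support P = X"
    and f: "continuous_on X f" and ae: "AE x in P. x \<in> X \<longrightarrow> f x = 0" and x: "x \<in> X"
  shows "f x = 0"
proof (rule ccontr)
  assume "f x \<noteq> 0"
  obtain V where V: "open V" "V \<inter> X = f -` (- {0}) \<inter> X"
    using continuous_on_open_invariant[THEN iffD1, OF f] open_Compl[OF closed_singleton] by metis
  have "x \<in> V" using V(2) x \<open>f x \<noteq> 0\<close> by auto
  then have pos: "emeasure P V > 0" using x V(1) unfolding X[symmetric] measure_support_def by auto
  have "AE y in P. y \<notin> V"
    using ae AE_in_measure_support[OF P] unfolding X
  proof eventually_elim
    case (elim y)
    then show ?case using V(2) by auto
  qed
  moreover have "V \<in> sets P" using V(1) P by simp
  ultimately have "emeasure P V = 0"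
    using sets.sets_into_space[of V P] by (subst (asm) AE_iff_measurable[of V]) auto
  then show False using pos by simp
qed

text \<open>Almost everywhere equalities between continuous functions become pointwise by full
  support. The index \<open>i\<close> stands for \<open>Suc i\<close>, and those outside
  \<open>J\<close> receive zero pairs, which contribute nothing to any series.\<close>

lemma mercer_system_of_eigen_system:
  fixes X :: "'a::euclidean_space set"
  assumes X: "compact X" and K: "mercer_kernel X K"
    and P: "prob_space P" "sets P = sets borel" "measure_support P = X"
    and eigen: "eigen_system P X K J lam phi"
  shows "mercer_system (restrict_space P X) X K
     (\<lambda>i. if Suc i \<in> J then lam (Suc i) else 0) (\<lambda>i. if Suc i \<in> J then phi (Suc i) else (\<lambda>_. 0))"
proof -
  let ?Q = "restrict_space P X"
  let ?l = "\<lambda>i. if Suc i \<in> J then lam (Suc i) else 0"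
  let ?p = "\<lambda>i. if Suc i \<in> J then phi (Suc i) else (\<lambda>_. 0)"
  interpret P: prob_space P by (rule P(1))
  have XP: "X \<in> sets P" using X P(2) by (simp add: borel_compact)
  have XP': "X \<inter> space P \<in> sets P" using XP by auto
  have "emeasure P X = 1"
    using AE_in_measure_support[OF P(2)] XP unfolding P(3) by (rule P.emeasure_eq_1_AE[rotated])
  then have Q: "prob_space ?Q" by (intro prob_space_restrict_space XP)
  have AEQ: "(AE x in ?Q. R x) \<longleftrightarrow> (AE x in P. x \<in> X \<longrightarrow> R x)" for R
    by (rule AE_restrict_space_iff[OF XP'])
  have comp: "compact_kernel ?Q X K"
  proof (intro compact_kernel.intro compact_kernel_axioms.intro)
    show "sets ?Q = sets (restrict_space borel X)" by (rule sets_restrict_space_cong[OF P(2)])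
    show "f x = 0" if "continuous_on X f" "AE x in ?Q. f x = 0" "x \<in> X" for f :: "'a \<Rightarrow> real" and x
      using continuous_AE_eq_0[OF P(2,3) that(1) _ that(3)] that(2) unfolding AEQ by blast
  qed (use K X Q in \<open>auto simp: mercer_kernel_def\<close>)
  then interpret C: compact_kernel ?Q X K .
  have inner: "inner_on P X f g = C.ip f g" for f g
    by (simp add: inner_on_def C.ip_def set_lebesgue_integral_def integral_restrict_space[OF XP'])
  have op: "integral_op P X K f = C.T f" for f
    by (rule ext) (simp add: integral_op_def C.T_def set_lebesgue_integral_def integral_restrict_space[OF XP'])
  have E: "J = {1..} \<or> (\<exists>r. J = {1..r})" "\<And>j. j \<in> J \<Longrightarrow> 0 \<le> lam j"
    "\<And>j. j \<in> J \<Longrightarrow> continuous_on X (phi j)"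
    "\<And>i j. i \<in> J \<Longrightarrow> j \<in> J \<Longrightarrow> C.ip (phi i) (phi j) = (if i = j then 1 else 0)"
    "\<And>j. j \<in> J \<Longrightarrow> AE x in ?Q. C.T (phi j) x = lam j * phi j x"
    "\<And>a f. square_integrable_on P X f \<Longrightarrow> (AE x in ?Q. C.T f x = a * f x) \<Longrightarrow>
        (\<And>j. j \<in> J \<Longrightarrow> lam j = a \<Longrightarrow> C.ip f (phi j) = 0) \<Longrightarrow> (AE x in ?Q. f x = 0)"
  proof -
    note e = eigen[unfolded eigen_system_def inner op ae_eq_on_def AEQ[symmetric]]
    note e2 = e[THEN conjunct2] note e3 = e2[THEN conjunct2, THEN conjunct2]
    note e4 = e3[THEN conjunct2] note e5 = e4[THEN conjunct2]
    show "J = {1..} \<or> (\<exists>r. J = {1..r})" by (rule e[THEN conjunct1])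
    show "0 \<le> lam j" if "j \<in> J" for j using e2[THEN conjunct1] that by (rule bspec)
    show "continuous_on X (phi j)" if "j \<in> J" for j using e3[THEN conjunct1] that by (rule bspec)
    show "C.ip (phi i) (phi j) = (if i = j then 1 else 0)" if "i \<in> J" "j \<in> J" for i j
      using e4[THEN conjunct1] that by (elim ballE) auto
    show "AE x in ?Q. C.T (phi j) x = lam j * phi j x" if "j \<in> J" for j
      using e5[THEN conjunct1] that by (rule bspec)
    show "AE x in ?Q. f x = 0" if "square_integrable_on P X f" "AE x in ?Q. C.T f x = a * f x"
      "\<And>j. j \<in> J \<Longrightarrow> lam j = a \<Longrightarrow> C.ip f (phi j) = 0" for a f
      by (rule e5[THEN conjunct2, THEN spec[of _ a], THEN spec[of _ f], THEN mp]) (use that in simp)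
  qed
  have J1: "j \<ge> 1" if "j \<in> J" for j using E(1) that by auto
  show ?thesis
  proof (intro mercer_system.intro psd_compact_kernel.intro comp psd_compact_kernel_axioms.intro
      mercer_system_axioms.intro)
    show "(\<Sum>x\<in>F. \<Sum>y\<in>F. c x * c y * K x y) \<ge> 0" if "finite F" "F \<subseteq> X" for F c
      using K that by (auto simp: mercer_kernel_def)
    show "0 \<le> ?l i" for i using E(2) by simp
    show pc: "continuous_on X (?p i)" for i using E(3) by simp
    show "C.T (?p i) x = ?l i * ?p i x" if "x \<in> X" for i x
    proof (cases "Suc i \<in> J")
      case True
      have "C.T (phi (Suc i)) x - lam (Suc i) * phi (Suc i) x = 0"
        by (rule C.full_support[of "\<lambda>x. C.T (phi (Suc i)) x - lam (Suc i) * phi (Suc i) x"])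
           (use E(3,5)[OF True] that in \<open>auto intro!: continuous_intros C.T_continuous\<close>)
      then show ?thesis using True by simp
    qed (simp add: C.T_def)
    show "?l i * C.ip (?p i) (?p j) = (if i = j then ?l i else 0)" for i j
      by (auto simp: E(4)) (auto simp: C.ip_def)
    show "f x = 0" if f: "continuous_on X f" and orth: "\<And>i. C.ip f (?p i) = 0"
      and ev: "\<And>x. x \<in> X \<Longrightarrow> C.T f x = a * f x" and x: "x \<in> X" for f a x
    proof (rule C.full_support[OF f _ x], rule E(6))
      show "square_integrable_on P X f"
        unfolding square_integrable_on_def
      proof
        show "set_borel_measurable P X f"
          using C.measurable_continuous[OF f]
          unfolding set_borel_measurable_def borel_measurable_restrict_space_iff[OF XP'] .
        have "integrable ?Q (\<lambda>x. (f x)\<^sup>2)" by (intro C.integrable_continuous continuous_intros f)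
        then show "set_integrable P X (\<lambda>x. (f x)\<^sup>2)"
          by (simp add: set_integrable_def integrable_restrict_space[OF XP'])
      qed
      show "AE x in ?Q. C.T f x = a * f x" by (rule AE_I2) (simp add: C.space_Q ev)
      show "C.ip f (phi j) = 0" if "j \<in> J" for j
        using orth[of "j - 1"] J1[OF that] that by simp
    qed
  qed
qed

section \<open>Eigenvalue tails and bounds in expectation\<close>

text \<open>Each weight \<open>i - m + 1\<close> is at least \<open>1\<close>, so the numerators of
  \<open>eigen_tail\<close> dominate the plain terms; multiplying by the common denominator gives
  the bound for every partial sum.\<close>

lemma ennreal_eigenvalue_tail_le:
  assumes tail: "eigen_tail \<rho> X J lam phi m \<le> S" and S: "S < \<infinity>"
    and nonneg: "\<And>j. j \<in> J \<Longrightarrow> 0 \<le> lam j" and m: "1 \<le> m" "m \<in> J"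
  shows "(\<Sum>i. ennreal ((if Suc (i + (m - 1)) \<in> J then lam (Suc (i + (m - 1))) else 0)
            * norm_sq_on \<rho> X (phi (Suc (i + (m - 1))))))
     \<le> S * ennreal (lam m * norm_sq_on \<rho> X (phi m))"
proof (rule suminf_le_const[OF summableI])
  fix n
  define a where "a j = lam j * norm_sq_on \<rho> X (phi j)" for j
  have norm0: "norm_sq_on \<rho> X f \<ge> 0" for f
    unfolding norm_sq_on_def set_lebesgue_integral_def by (rule integral_nonneg_AE) simp
  have a0: "a j \<ge> 0" if "j \<in> J" for j using nonneg[OF that] norm0 by (simp add: a_def)
  define t where "t j = ennreal (real (j - m + 1) * a j) / ennreal (a m)" for j
  define F where "F = {j \<in> J. m \<le> j \<and> j < m + n}"
  have tail_t: "eigen_tail \<rho> X J lam phi m = infsum t {i \<in> J. m \<le> i}"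
    unfolding eigen_tail_def t_def a_def by (simp add: mult.assoc)
  have finF: "finite F" by (rule finite_subset[of _ "{..<m + n}"]) (auto simp: F_def)
  have sumt: "sum t F \<le> S"
  proof -
    have "infsum t F \<le> infsum t {i \<in> J. m \<le> i}"
      by (rule infsum_mono_neutral[OF nonneg_summable_on_complete nonneg_summable_on_complete])
         (auto simp: F_def)
    then have "sum t F \<le> infsum t {i \<in> J. m \<le> i}" using finF by simp
    then show ?thesis using tail unfolding tail_t by (rule order_trans)
  qed
  have le: "ennreal (a j) \<le> t j * ennreal (a m)" if j: "j \<in> F" for j
  proof -
    have jJ: "j \<in> J" using j by (simp add: F_def)
    have "t j \<le> sum t F" by (rule member_le_sum[OF j]) (use finF in auto)
    then have tj: "t j < \<infinity>" using sumt S by (meson order_le_less_trans)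
    have "a j \<le> real (j - m + 1) * a j"
      using a0[OF jJ] mult_right_mono[of 1 "real (j - m + 1)" "a j"] by simp
    then have 1: "ennreal (a j) \<le> ennreal (real (j - m + 1) * a j)" by (rule ennreal_leI)
    show ?thesis
    \<comment> \<open>The convention for a vanishing denominator matters here: if
      \<open>a m = 0\<close>, a nonzero numerator would make \<open>t j\<close> infinite, against
      the finite tail, so the numerator is \<open>0\<close>.\<close>
    proof (cases "a m = 0")
      case True
      then have "ennreal (real (j - m + 1) * a j) = 0"
        using tj by (auto simp: t_def ennreal_divide_zero split: if_splits)
      then show ?thesis using 1 by simp
    next
      case False
      then have "t j * ennreal (a m) = ennreal (real (j - m + 1) * a j)"
        unfolding t_def using a0[OF m(2)] by (simp add: ennreal_divide_times ennreal_times_divide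
          ennreal_mult_divide_eq)
      then show ?thesis using 1 by simp
    qed
  qed
  have "(\<Sum>i<n. ennreal ((if Suc (i + (m - 1)) \<in> J then lam (Suc (i + (m - 1))) else 0)
            * norm_sq_on \<rho> X (phi (Suc (i + (m - 1))))))
     = (\<Sum>j\<in>{m..<m + n}. if j \<in> J then ennreal (a j) else 0)"
    by (rule sum.reindex_bij_witness[of _ "\<lambda>j. j - m" "\<lambda>i. i + m"]) (use m in \<open>auto simp: a_def\<close>)
  also have "\<dots> = (\<Sum>j\<in>F. ennreal (a j))"
    unfolding F_def by (subst sum.inter_filter[symmetric]) (auto intro!: sum.cong)
  also have "\<dots> \<le> (\<Sum>j\<in>F. t j * ennreal (a m))" by (rule sum_mono[OF le])
  also have "\<dots> \<le> S * ennreal (a m)"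
    unfolding sum_distrib_right[symmetric] by (rule mult_right_mono[OF sumt]) simp
  finally show "(\<Sum>i<n. ennreal ((if Suc (i + (m - 1)) \<in> J then lam (Suc (i + (m - 1))) else 0)
            * norm_sq_on \<rho> X (phi (Suc (i + (m - 1))))))
     \<le> S * ennreal (lam m * norm_sq_on \<rho> X (phi m))" by (simp add: a_def)
qed

theorem corollary1:
  fixes X :: "(real ^ 'd) set"
    and K :: "real ^ 'd \<Rightarrow> real ^ 'd \<Rightarrow> real"
    and P \<rho> :: "(real ^ 'd) measure"
    and J :: "nat set"
    and lam :: "nat \<Rightarrow> real"
    and phi :: "nat \<Rightarrow> real ^ 'd \<Rightarrow> real"
  assumes "compact X"
    and "mercer_kernel X K"
    and "prob_space P" "sets P = sets borel" "measure_support P = X"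
    and "prob_space \<rho>" "sets \<rho> = sets borel" "measure_support \<rho> \<subseteq> X"
    and "eigen_system P X K J lam phi"
    and "integral_op_injective P X K"
    and "absolutely_continuous P \<rho>"
    and "\<exists>b::real. AE x in P. x \<in> X \<longrightarrow> RN_deriv P \<rho> x \<le> ennreal b"
  shows "\<forall>S::ennreal. S < \<infinity> \<longrightarrow> (\<exists>C::real. C > 0 \<and>
    (\<forall>(n::nat) (N::nat) (m::nat) (M::'w measure) (Z :: nat \<Rightarrow> 'w \<Rightarrow> real ^ 'd).
       1 \<le> N \<and> N \<le> n \<and> 1 \<le> m \<and> m \<le> N \<and> m \<in> J \<and>
       eigen_tail \<rho> X J lam phi m \<le> S \<and> iid_sample M \<rho> n Z \<longrightarrow>
       (\<integral>\<^sup>+\<omega>. ennreal (\<Sum>j=m..N. singular_value j (gram_submatrix K n N (\<lambda>i. Z i \<omega>))) \<partial>M)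
         \<le> ennreal (C * (lam m * norm_sq_on \<rho> X (phi m))) \<and>
       (\<integral>\<^sup>+\<omega>. ennreal (\<Sum>j=m..N. (singular_value j (gram_submatrix K n N (\<lambda>i. Z i \<omega>)))\<^sup>2) \<partial>M)
         \<le> ennreal (C * ((SUP x\<in>X. K x x) / real m * (lam m * norm_sq_on \<rho> X (phi m))))))"
proof (intro allI impI)
  fix S :: ennreal assume S: "S < \<infinity>"
  define l where "l i = (if Suc i \<in> J then lam (Suc i) else 0)" for i
  define p where "p i = (if Suc i \<in> J then phi (Suc i) else (\<lambda>_. 0))" for i
  interpret mercer_system "restrict_space P X" X K l p
    unfolding l_def p_def
    by (rule mercer_system_of_eigen_system[OF assms(1,2,3,4,5,9)])
  interpret \<rho>: prob_space \<rho> by (rule assms(6))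
  define \<kappa> where "\<kappa> = (SUP x\<in>X. K x x)"
  have X_ne: "X \<noteq> {}" using not_empty space_Q by simp
  have K_le: "K x x \<le> \<kappa>" if "x \<in> X" for x
    unfolding \<kappa>_def
    by (intro cSUP_upper[OF that] bounded_imp_bdd_above compact_imp_bounded
        compact_continuous_image K_cont_diag compact_X)
  \<comment> \<open>The diagonal is nonnegative by the bound for an empty set of eigenpairs.\<close>
  have \<kappa>0: "\<kappa> \<ge> 0"
  proof -
    obtain x where x: "x \<in> X" using X_ne by auto
    show ?thesis using eigen_sum_le_diagonal[OF x, of "{}"] K_le[OF x] by simp
  qed
  have AE\<rho>: "AE x in \<rho>. x \<in> X"
    using AE_in_measure_support[OF assms(7)] assms(8) by (auto elim: eventually_mono)
  \<comment> \<open>Outside \<open>X\<close> the eigenfunctions are arbitrary; the cut-off makes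
    their squares Borel on the whole space.\<close>
  define w where "w i x = indicator X x * (p i x)\<^sup>2" for i x
  have w_meas: "w i \<in> borel_measurable borel" for i
    using borel_measurable_continuous_on_indicator[of X "\<lambda>x. (p i x)\<^sup>2"] assms(1) p_cont[of i]
    unfolding w_def by (simp add: borel_compact continuous_on_power)
  have w_meas': "w i \<in> borel_measurable \<rho>" for i
    using w_meas measurable_cong_sets[OF assms(7) refl] by blast
  have w_int: "(\<integral>\<^sup>+x. ennreal (w i x) \<partial>\<rho>) = ennreal (norm_sq_on \<rho> X (p i))" for i
  proof -
    obtain B where B: "\<And>x. x \<in> X \<Longrightarrow> \<bar>p i x\<bar> \<le> B" using continuous_bounded[OF p_cont[of i]] by metis
    have "norm (w i x) \<le> B\<^sup>2" for x
      using B[of x] abs_le_square_iff[of "p i x" B] by (cases "x \<in> X") (auto simp: w_def)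
    then have "integrable \<rho> (w i)"
      by (intro \<rho>.integrable_const_bound[of _ "B\<^sup>2"] w_meas') auto
    then have "(\<integral>\<^sup>+x. ennreal (w i x) \<partial>\<rho>) = ennreal (\<integral>x. w i x \<partial>\<rho>)"
      by (rule nn_integral_eq_integral) (auto simp: w_def)
    then show ?thesis
      by (simp add: norm_sq_on_def set_lebesgue_integral_def w_def)
  qed
  \<comment> \<open>The summand \<open>1\<close> keeps the constant positive when
    \<open>S = 0\<close>.\<close>
  define C where "C = enn2real S + 1"
  have C: "C > 0" by (simp add: C_def add_nonneg_pos)
  have SC: "S \<le> ennreal C" using S by (cases S) (auto simp: C_def)
  show "\<exists>C::real. C > 0 \<and>
    (\<forall>(n::nat) (N::nat) (m::nat) (M::'w measure) (Z :: nat \<Rightarrow> 'w \<Rightarrow> real ^ 'd).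
       1 \<le> N \<and> N \<le> n \<and> 1 \<le> m \<and> m \<le> N \<and> m \<in> J \<and>
       eigen_tail \<rho> X J lam phi m \<le> S \<and> iid_sample M \<rho> n Z \<longrightarrow>
       (\<integral>\<^sup>+\<omega>. ennreal (\<Sum>j=m..N. singular_value j (gram_submatrix K n N (\<lambda>i. Z i \<omega>))) \<partial>M)
         \<le> ennreal (C * (lam m * norm_sq_on \<rho> X (phi m))) \<and>
       (\<integral>\<^sup>+\<omega>. ennreal (\<Sum>j=m..N. (singular_value j (gram_submatrix K n N (\<lambda>i. Z i \<omega>)))\<^sup>2) \<partial>M)
         \<le> ennreal (C * ((SUP x\<in>X. K x x) / real m * (lam m * norm_sq_on \<rho> X (phi m)))))"
    unfolding \<kappa>_def[symmetric]
  proof (rule exI[of _ C], intro conjI C allI impI; (elim conjE)?)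
    fix n N m :: nat and M :: "'w measure" and Z :: "nat \<Rightarrow> 'w \<Rightarrow> real ^ 'd"
    assume N: "1 \<le> N" "N \<le> n" and m: "1 \<le> m" "m \<le> N" "m \<in> J"
      and tail: "eigen_tail \<rho> X J lam phi m \<le> S" and iid: "iid_sample M \<rho> n Z"
    define D where "D = lam m * norm_sq_on \<rho> X (phi m)"
    define A where "A \<omega> = gram_submatrix K n N (\<lambda>i. Z i \<omega>)" for \<omega>
    interpret M: prob_space M using iid by (simp add: iid_sample_def)
    have Zm: "Z i \<in> M \<rightarrow>\<^sub>M borel" and Zd: "distr M borel (Z i) = \<rho>" if "i \<in> {1..n}" for i
      using iid that unfolding iid_sample_def M.indep_vars_def by auto
    have "AE \<omega> in M. Z i \<omega> \<in> X" if "i \<in> {1..n}" for i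
      using AE_distrD[OF Zm[OF that]] AE\<rho> unfolding Zd[OF that, symmetric] by blast
    then have Z_X: "AE \<omega> in M. \<forall>i\<in>{1..n}. Z i \<omega> \<in> X" by (intro AE_finite_allI) auto
    \<comment> \<open>The share of one sample point in the trace tail, up to the factor
      \<open>1 / real n\<close>. The shift \<open>m - 1\<close> leads from the one-based
      \<open>m\<close> to the zero-based \<open>l\<close> and \<open>w\<close>.\<close>
    define W where "W x = (\<Sum>i. ennreal (l (i + (m - 1))) * ennreal (w (i + (m - 1)) x))" for x
    have W_meas: "W \<in> borel_measurable \<rho>" unfolding W_def using w_meas' by measurable
    have W_eq: "ennreal (\<Sum>i. l (i + (m - 1)) * (p (i + (m - 1)) x)\<^sup>2) = W x" if "x \<in> X" for x
    proof -
      have "W x = (\<Sum>i. ennreal (l (i + (m - 1)) * (p (i + (m - 1)) x)\<^sup>2))"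
        unfolding W_def using that l_nonneg by (simp add: w_def ennreal_mult)
      then show ?thesis
        using l_nonneg diagonal_summable[OF that] by (simp add: suminf_ennreal2)
    qed
    have W_int: "(\<integral>\<^sup>+x. W x \<partial>\<rho>) \<le> ennreal (C * D)"
    proof -
      have "(\<integral>\<^sup>+x. W x \<partial>\<rho>) = (\<Sum>i. ennreal (l (i + (m - 1))) * ennreal (norm_sq_on \<rho> X (p (i + (m - 1)))))"
        unfolding W_def using w_meas'
        by (subst nn_integral_suminf) (auto simp: nn_integral_cmult w_int)
      also have "\<dots> = (\<Sum>i. ennreal ((if Suc (i + (m - 1)) \<in> J then lam (Suc (i + (m - 1))) else 0)
            * norm_sq_on \<rho> X (phi (Suc (i + (m - 1))))))"
        using l_nonneg by (intro arg_cong[of _ _ suminf] ext) (auto simp: ennreal_mult'[symmetric] l_def p_def)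
      also have "\<dots> \<le> S * ennreal D"
        unfolding D_def
        by (rule ennreal_eigenvalue_tail_le[OF tail S _ m(1,3)])
           (use assms(9) in \<open>auto simp: eigen_system_def\<close>)
      also have "\<dots> \<le> ennreal C * ennreal D" by (rule mult_right_mono[OF SC]) simp
      also have "\<dots> = ennreal (C * D)" using C by (simp add: ennreal_mult')
      finally show ?thesis .
    qed
    have reindex: "(\<Sum>j=m..N. h (singular_value j B)) = (\<Sum>j\<in>{m - 1..<N}. h (singular_values B ! j))"
      for h :: "real \<Rightarrow> real" and B
      by (rule sum.reindex_bij_witness[of _ Suc "\<lambda>j. j - 1"]) (use m in \<open>auto simp: singular_value_def\<close>)
    have bound: "ennreal (\<Sum>j=m..N. singular_value j (A \<omega>)) \<le> (\<Sum>k<n. ennreal (1 / real n) * W (Z (Suc k) \<omega>))"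
      if \<omega>: "\<forall>i\<in>{1..n}. Z i \<omega> \<in> X" for \<omega>
    proof -
      have "(\<Sum>j=m..N. singular_value j (A \<omega>)) \<le>
          (\<Sum>k<n. (1 / real n) * (\<Sum>i. l (i + (m - 1)) * (p (i + (m - 1)) (Z (Suc k) \<omega>))\<^sup>2))"
        unfolding reindex[of "\<lambda>x. x"] A_def by (rule gram_singular_values_tail) (use \<omega> N in auto)
      then have "ennreal (\<Sum>j=m..N. singular_value j (A \<omega>)) \<le>
          ennreal (\<Sum>k<n. (1 / real n) * (\<Sum>i. l (i + (m - 1)) * (p (i + (m - 1)) (Z (Suc k) \<omega>))\<^sup>2))"
        by (rule ennreal_leI)
      also have "\<dots> = (\<Sum>k<n. ennreal ((1 / real n) * (\<Sum>i. l (i + (m - 1)) * (p (i + (m - 1)) (Z (Suc k) \<omega>))\<^sup>2)))"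
        using \<omega> l_nonneg
        by (intro sum_ennreal[symmetric] mult_nonneg_nonneg suminf_nonneg diagonal_summable) auto
      also have "\<dots> = (\<Sum>k<n. ennreal (1 / real n) * W (Z (Suc k) \<omega>))"
      proof (rule sum.cong[OF refl])
        fix k assume "k \<in> {..<n}"
        then have "Z (Suc k) \<omega> \<in> X" using \<omega> by auto
        from W_eq[OF this, symmetric] show "ennreal ((1 / real n) * (\<Sum>i. l (i + (m - 1)) * (p (i + (m - 1)) (Z (Suc k) \<omega>))\<^sup>2))
          = ennreal (1 / real n) * W (Z (Suc k) \<omega>)"
          by (simp only:) (rule ennreal_mult', simp)
      qed
      finally show ?thesis .
    qed
    have Wmb: "W \<in> borel_measurable borel" using W_meas measurable_cong_sets[OF assms(7) refl] by blast
    have WZ: "(\<lambda>\<omega>. W (Z (Suc k) \<omega>)) \<in> borel_measurable M" if "k < n" for k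
      by (rule measurable_compose[OF Zm Wmb]) (use that in simp)
    have WZ_int: "(\<integral>\<^sup>+\<omega>. W (Z (Suc k) \<omega>) \<partial>M) = (\<integral>\<^sup>+x. W x \<partial>\<rho>)" if "k < n" for k
      using Zm[of "Suc k"] Zd[of "Suc k"] that nn_integral_distr[of "Z (Suc k)" M borel W] Wmb by auto
    \<comment> \<open>Measurability is established for this majorant; the singular values enter
      through monotonicity of the nonnegative integral. As all points have law
      \<open>\<rho>\<close>, the mean over them integrates to the integral of
      \<open>W\<close>.\<close>
    define E1 where "E1 \<omega> = (\<Sum>k<n. ennreal (1 / real n) * W (Z (Suc k) \<omega>))" for \<omega>
    have E1_meas: "E1 \<in> borel_measurable M" unfolding E1_def using WZ by measurable
    have E1_int: "(\<integral>\<^sup>+\<omega>. E1 \<omega> \<partial>M) \<le> ennreal (C * D)"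
    proof -
      have "(\<integral>\<^sup>+\<omega>. E1 \<omega> \<partial>M) = (\<Sum>k<n. ennreal (1 / real n) * (\<integral>\<^sup>+x. W x \<partial>\<rho>))"
        unfolding E1_def using WZ by (subst nn_integral_sum) (auto simp: nn_integral_cmult WZ_int)
      also have "\<dots> = (ennreal (real n) * ennreal (1 / real n)) * (\<integral>\<^sup>+x. W x \<partial>\<rho>)"
        by (simp add: mult.assoc ennreal_of_nat_eq_real_of_nat)
      also have "ennreal (real n) * ennreal (1 / real n) = 1"
        using N by (simp add: ennreal_mult'[symmetric])
      finally show ?thesis using W_int by simp
    qed
    show "(\<integral>\<^sup>+\<omega>. ennreal (\<Sum>j=m..N. singular_value j (gram_submatrix K n N (\<lambda>i. Z i \<omega>))) \<partial>M)
         \<le> ennreal (C * (lam m * norm_sq_on \<rho> X (phi m)))"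
    proof -
      have "(\<integral>\<^sup>+\<omega>. ennreal (\<Sum>j=m..N. singular_value j (A \<omega>)) \<partial>M) \<le> (\<integral>\<^sup>+\<omega>. E1 \<omega> \<partial>M)"
        by (rule nn_integral_mono_AE, rule eventually_mono[OF Z_X]) (simp add: bound E1_def)
      also note E1_int
      finally show ?thesis by (simp add: A_def D_def)
    qed
    show "(\<integral>\<^sup>+\<omega>. ennreal (\<Sum>j=m..N. (singular_value j (gram_submatrix K n N (\<lambda>i. Z i \<omega>)))\<^sup>2) \<partial>M)
         \<le> ennreal (C * (\<kappa> / real m * (lam m * norm_sq_on \<rho> X (phi m))))"
    proof -
      have "ennreal (\<Sum>j=m..N. (singular_value j (A \<omega>))\<^sup>2) \<le> ennreal (\<kappa> / real m) * E1 \<omega>"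
        if \<omega>: "\<forall>i\<in>{1..n}. Z i \<omega> \<in> X" for \<omega>
      proof -
        have carr: "A \<omega> \<in> carrier_mat n N" by (simp add: A_def gram_submatrix_def)
        have nonneg: "singular_values (A \<omega>) ! j \<ge> 0" if "j < N" for j
          using singular_values_decomposition[OF carr] that by metis
        have "(\<Sum>j\<in>{m - 1..<N}. (singular_values (A \<omega>) ! j)\<^sup>2) \<le>
            (\<Sum>j\<in>{m - 1..<N}. \<kappa> / real m * singular_values (A \<omega>) ! j)"
        proof (rule sum_mono)
          fix j assume j: "j \<in> {m - 1..<N}"
          have "singular_values (A \<omega>) ! j \<le> \<kappa> / real (Suc j)"
            unfolding A_def by (rule gram_singular_value_le) (use \<omega> j N K_le in auto)
          \<comment> \<open>Since \<open>j\<close> counts from \<open>0\<close>, the range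
            \<open>j \<ge> m - 1\<close> means \<open>Suc j \<ge> m\<close>; one factor of each
            square is thus at most \<open>\<kappa> / real m\<close>.\<close>
          also have "\<dots> \<le> \<kappa> / real m" using j m \<kappa>0 by (intro divide_left_mono) auto
          finally have "singular_values (A \<omega>) ! j * singular_values (A \<omega>) ! j \<le>
              \<kappa> / real m * singular_values (A \<omega>) ! j"
            by (rule mult_right_mono) (use nonneg j in auto)
          then show "(singular_values (A \<omega>) ! j)\<^sup>2 \<le> \<kappa> / real m * singular_values (A \<omega>) ! j"
            by (simp add: power2_eq_square)
        qed
        then have "(\<Sum>j=m..N. (singular_value j (A \<omega>))\<^sup>2) \<le> \<kappa> / real m * (\<Sum>j=m..N. singular_value j (A \<omega>))"
          unfolding reindex[of "\<lambda>x. x\<^sup>2"] reindex[of "\<lambda>x. x"] sum_distrib_left .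
        then have "ennreal (\<Sum>j=m..N. (singular_value j (A \<omega>))\<^sup>2) \<le>
            ennreal (\<kappa> / real m) * ennreal (\<Sum>j=m..N. singular_value j (A \<omega>))"
          using \<kappa>0 by (subst ennreal_mult'[symmetric]) (auto intro: ennreal_leI)
        also have "\<dots> \<le> ennreal (\<kappa> / real m) * E1 \<omega>"
          unfolding E1_def by (rule mult_left_mono[OF bound[OF \<omega>]]) simp
        finally show ?thesis .
      qed
      then have "(\<integral>\<^sup>+\<omega>. ennreal (\<Sum>j=m..N. (singular_value j (A \<omega>))\<^sup>2) \<partial>M) \<le> (\<integral>\<^sup>+\<omega>. ennreal (\<kappa> / real m) * E1 \<omega> \<partial>M)"
        by (intro nn_integral_mono_AE eventually_mono[OF Z_X]) simp
      also have "\<dots> = ennreal (\<kappa> / real m) * (\<integral>\<^sup>+\<omega>. E1 \<omega> \<partial>M)"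
        by (rule nn_integral_cmult[OF E1_meas])
      also have "\<dots> \<le> ennreal (\<kappa> / real m) * ennreal (C * D)"
        by (rule mult_left_mono[OF E1_int]) simp
      also have "\<dots> = ennreal (\<kappa> / real m * (C * D))" using \<kappa>0 by (intro ennreal_mult'[symmetric]) simp
      also have "\<kappa> / real m * (C * D) = C * (\<kappa> / real m * D)" by simp
      finally show ?thesis by (simp only: A_def D_def)
    qed
  qed
qed

end
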